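(* Let $X$ be a $K_4$-free graph with $|V(X)|=3p$, and let $d=2p\ge \Delta(X)$. One can construct, in polynomial time, a simple $d$-regular $K_4$-free graph $H$ of odd order such that, under a natural embedding $V(X)\subseteq V(H)$, the triangle vertex-sets of $H$ are exactly those of $X$. Moreover, $H$ satisfies $|V(H)|\ge 2d+2$. Consequently, $X$ has $p$ pairwise vertex-disjoint triangles if and only if $H$ has $d/2$ pairwise vertex-disjoint triangles.
   Context: All graphs are finite, simple and undirected. $\Delta(X)$ denotes the maximum degree of $X$. A graph is $K_4$-free if it contains no four pairwise adjacent vertices. A triangle vertex-set of a graph is a set of three pairwise adjacent vertices. The order of a graph is its number of vertices. "Natural embedding $V(X)\subseteq V(H)$" means that the vertices of $X$ are kept as vertices of $H$ (with further new vertices added), so that subsets of $V(X)$ are regarded as subsets of $V(H)$. "Polynomial time" means time polynomial in the size of $X$, i.e. there is a polynomial-time algorithm that on input $X$ (with $|V(X)|=3p$ and $2p\ge\Delta(X)$) outputs $H$. *)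

theory Defs
  imports "HOL-Computational_Algebra.Polynomial"
begin

section \<open>Finite simple graphs\<close>

record 'a ugraph =
  verts :: "'a set"
  edges :: "'a set set"

definition simple_graph :: "'a ugraph \<Rightarrow> bool" where
  "simple_graph G \<longleftrightarrow>
     finite (verts G) \<and> (\<forall>e\<in>edges G. e \<subseteq> verts G \<and> card e = 2)"

definition vertex_degree :: "'a ugraph \<Rightarrow> 'a \<Rightarrow> nat" where
  "vertex_degree G v = card {e \<in> edges G. v \<in> e}"

text \<open>The inserted 0 only matters for the graph without vertices, whose maximum degree is 0.\<close>

definition max_degree :: "'a ugraph \<Rightarrow> nat" where
  "max_degree G = Max (insert 0 (vertex_degree G ` verts G))"

definition regular :: "nat \<Rightarrow> 'a ugraph \<Rightarrow> bool" where
  "regular d G \<longleftrightarrow> (\<forall>v\<in>verts G. vertex_degree G v = d)"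

definition clique :: "'a ugraph \<Rightarrow> 'a set \<Rightarrow> bool" where
  "clique G S \<longleftrightarrow> S \<subseteq> verts G \<and> (\<forall>u\<in>S. \<forall>v\<in>S. u \<noteq> v \<longrightarrow> {u, v} \<in> edges G)"

definition K4_free :: "'a ugraph \<Rightarrow> bool" where
  "K4_free G \<longleftrightarrow> \<not> (\<exists>S. clique G S \<and> card S = 4)"

definition triangles :: "'a ugraph \<Rightarrow> 'a set set" where
  "triangles G = {T. clique G T \<and> card T = 3}"

definition has_disjoint_triangles :: "'a ugraph \<Rightarrow> nat \<Rightarrow> bool" where
  "has_disjoint_triangles G k \<longleftrightarrow>
     (\<exists>\<T>. \<T> \<subseteq> triangles G \<and> finite \<T> \<and> card \<T> = k \<and> pairwise disjnt \<T>)"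


section \<open>Polynomial time\<close>

text \<open>
  The machine model is a random access machine with structured control, finitely many
  registers per program, an addressable memory, and a write-only output tape of bits.
  Every elementary command and every evaluation of a guard costs one unit; expressions
  occurring in a fixed program have constant size. The only arithmetic operations are
  addition and truncated subtraction, so the bit length of every stored value is at most
  linear in the running time plus the bit length of the initial values. Therefore unit
  cost is polynomially related to the running time of Turing machines (this would fail
  with unit-cost multiplication).
\<close>

datatype aexp =
    Const nat
  | Reg nat
  | Mem aexp
  | Add aexp aexp
  | Sub aexp aexp

datatype com =
    Skip
  | Assign nat aexp
  | Store aexp aexp
  | Print aexp
  | Seq com com
  | Cond aexp com com
  | While aexp com

record state =
  reg :: "nat \<Rightarrow> nat"
  mem :: "nat \<Rightarrow> nat"
  out :: "bool list"

primrec aval :: "aexp \<Rightarrow> state \<Rightarrow> nat" where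
  "aval (Const n) s = n"
| "aval (Reg r) s = reg s r"
| "aval (Mem a) s = mem s (aval a s)"
| "aval (Add a b) s = aval a s + aval b s"
| "aval (Sub a b) s = aval a s - aval b s"

text \<open>\<open>exec c s t s'\<close>: started in \<open>s\<close>, the program \<open>c\<close> halts in \<open>s'\<close> after exactly \<open>t\<close> steps.
  Guards and printed values count as true iff they are nonzero.\<close>

inductive exec :: "com \<Rightarrow> state \<Rightarrow> nat \<Rightarrow> state \<Rightarrow> bool" where
  Skip: "exec Skip s 1 s"
| Assign: "exec (Assign r a) s 1 (s\<lparr>reg := (reg s)(r := aval a s)\<rparr>)"
| Store: "exec (Store a b) s 1 (s\<lparr>mem := (mem s)(aval a s := aval b s)\<rparr>)"
| Print: "exec (Print a) s 1 (s\<lparr>out := out s @ [aval a s \<noteq> 0]\<rparr>)"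
| Seq: "exec c1 s1 t1 s2 \<Longrightarrow> exec c2 s2 t2 s3 \<Longrightarrow> exec (Seq c1 c2) s1 (t1 + t2) s3"
| CondTrue: "aval a s \<noteq> 0 \<Longrightarrow> exec c1 s t s' \<Longrightarrow> exec (Cond a c1 c2) s (1 + t) s'"
| CondFalse: "aval a s = 0 \<Longrightarrow> exec c2 s t s' \<Longrightarrow> exec (Cond a c1 c2) s (1 + t) s'"
| WhileFalse: "aval a s = 0 \<Longrightarrow> exec (While a c) s 1 s"
| WhileTrue: "aval a s1 \<noteq> 0 \<Longrightarrow> exec c s1 t1 s2 \<Longrightarrow> exec (While a c) s2 t2 s3 \<Longrightarrow>
    exec (While a c) s1 (1 + t1 + t2) s3"

text \<open>The input word occupies the first memory cells, its length is in register 0.\<close>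

definition init_state :: "bool list \<Rightarrow> state" where
  "init_state w =
     \<lparr>reg = (\<lambda>r. if r = 0 then length w else 0),
      mem = (\<lambda>i. if i < length w then of_bool (w ! i) else 0),
      out = []\<rparr>"

text \<open>Nothing is required of the program on words outside the set \<open>D\<close> of admissible inputs.\<close>

definition polytime_on :: "bool list set \<Rightarrow> (bool list \<Rightarrow> bool list) \<Rightarrow> bool" where
  "polytime_on D f \<longleftrightarrow>
     (\<exists>c. \<exists>q :: nat poly. \<forall>w\<in>D. \<exists>t s.
        exec c (init_state w) t s \<and> out s = f w \<and> t \<le> poly q (length w))"


section \<open>Graphs as words\<close>

definition enumerates :: "'a list \<Rightarrow> 'a ugraph \<Rightarrow> bool" where
  "enumerates vs G \<longleftrightarrow> distinct vs \<and> set vs = verts G"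

text \<open>The order of the graph in unary, followed by the rows of the adjacency matrix with
  respect to the enumeration \<open>vs\<close> of the vertices. For graphs without loops the diagonal
  entries \<open>{u, u} \<in> edges G\<close> are false.\<close>

definition encode_graph :: "'a list \<Rightarrow> 'a ugraph \<Rightarrow> bool list" where
  "encode_graph vs G =
     replicate (length vs) True @ [False] @
     concat (map (\<lambda>u. map (\<lambda>v. {u, v} \<in> edges G) vs) vs)"

end

theory Submission
  imports Defs "HOL-Library.Countable"
begin

text \<open>
  The deficient degrees of \<open>X\<close> are repaired inside a covering of \<open>X\<close>. Take \<open>m = 4p = 2d\<close> sheets, each a
  copy of \<open>V(X)\<close>, and a permutation \<open>\<pi>\<close> of the sheets whose only fixed point is sheet \<open>0\<close>. Number
  the vertices of \<open>X\<close> and replace each edge \<open>uv\<close> with \<open>u < v\<close> by the \<open>m\<close> edges from \<open>(i, u)\<close> to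
  \<open>(\<pi> i, v)\<close>. A triangle \<open>u < v < w\<close> of \<open>X\<close> lifts to a triangle at \<open>(i, u)\<close> only if
  \<open>\<pi> (\<pi> i) = \<pi> i\<close>, that is, \<open>i = 0\<close>. So sheet \<open>0\<close> is a copy of \<open>X\<close>, no other triangle
  exists in the covering, and every lift of \<open>u\<close> has the degree of \<open>u\<close>.

  A lift of \<open>u\<close> now lacks \<open>d - deg u\<close> neighbours, the same number for all \<open>m\<close> lifts of \<open>u\<close>. They are
  supplied by a bipartite regular graph of that degree on the fibre over \<open>u\<close>, whose two sides are the
  lower \<open>d\<close> and the upper \<open>d\<close> sheets. A triangle that uses a fibre edge either stays in a bipartite
  fibre, or has a vertex over some \<open>v \<noteq> u\<close> that is adjacent to two lifts of \<open>u\<close>; a covering has no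
  such vertex. Hence the triangles are still those of sheet \<open>0\<close> (\<open>lifted_triangle\<close>), and the graph is
  \<open>d\<close>-regular (\<open>lifted_regular\<close>).

  The covering has the even order \<open>4p * 3p\<close>. A disjoint triangle-free \<open>d\<close>-regular circulant graph
  of order \<open>6p + 3 > 2d + 2\<close>, called the tail, makes the order odd; for \<open>p = 0\<close> it consists of three
  isolated vertices. A \<open>K\<^sub>4\<close> contains triangles through all its edges, so it would
  lie in \<open>X\<close> (\<open>K4_free_if_same_triangles\<close>), and the equivalence about packings holds because
  having \<open>p = d/2\<close> disjoint triangles depends on the set of triangles only
  (\<open>regular_supergraph\<close> collects all this).

  Whether two vertices are adjacent is decided by an arithmetic expression in their coordinates, one
  entry of the input matrix and one degree of \<open>X\<close>. A machine can therefore write the matrix with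
  nested counting loops, printing one expression per entry and never writing to its memory
  (\<open>polytime_lift_word\<close>).
\<close>

section \<open>Graphs drawn from an adjacency predicate\<close>

text \<open>
  The construction is described by an adjacency predicate on structured vertices; \<open>draw\<close> transports
  it along an injection to a graph on the required vertex type.
\<close>

definition draw :: "('a \<Rightarrow> 'b) \<Rightarrow> 'a set \<Rightarrow> ('a \<Rightarrow> 'a \<Rightarrow> bool) \<Rightarrow> 'b ugraph" where
  "draw \<phi> V a = \<lparr>verts = \<phi> ` V, edges = {{\<phi> x, \<phi> y} |x y. x \<in> V \<and> y \<in> V \<and> a x y}\<rparr>"

lemma verts_draw [simp]: "verts (draw \<phi> V a) = \<phi> ` V"
  by (simp add: draw_def)

lemma edge_draw_iff:
  assumes "inj_on \<phi> V" "symp a" "x \<in> V" "y \<in> V"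
  shows "{\<phi> x, \<phi> y} \<in> edges (draw \<phi> V a) \<longleftrightarrow> a x y"
  using assms by (auto simp: draw_def doubleton_eq_iff inj_on_eq_iff dest: sympD)

lemma simple_graph_draw:
  assumes "finite V" "inj_on \<phi> V" "irreflp a"
  shows "simple_graph (draw \<phi> V a)"
proof -
  have "card {\<phi> x, \<phi> y} = 2" if "x \<in> V" "y \<in> V" "a x y" for x y
    using that assms by (metis card_2_iff inj_onD irreflpD)
  then show ?thesis
    using assms(1) by (auto simp: simple_graph_def draw_def)
qed

lemma vertex_degree_draw:
  assumes "inj_on \<phi> V" "symp a" "x \<in> V"
  shows "vertex_degree (draw \<phi> V a) (\<phi> x) = card {y \<in> V. a x y}"
proof -
  have "{e \<in> edges (draw \<phi> V a). \<phi> x \<in> e} = (\<lambda>y. {\<phi> x, \<phi> y}) ` {y \<in> V. a x y}"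
    using assms by (auto simp: draw_def inj_on_eq_iff image_iff intro: sympD) (metis insert_commute sympD)
  moreover have "inj_on (\<lambda>y. {\<phi> x, \<phi> y}) {y \<in> V. a x y}"
    using assms by (auto intro!: inj_onI simp: doubleton_eq_iff inj_on_eq_iff)
  ultimately show ?thesis
    by (simp add: vertex_degree_def card_image)
qed

lemma encode_graph_draw:
  assumes "inj_on \<phi> (set xs)" "symp a"
  shows "encode_graph (map \<phi> xs) (draw \<phi> (set xs) a) =
    replicate (length xs) True @ [False] @ concat (map (\<lambda>x. map (a x) xs) xs)"
proof -
  have "map (\<lambda>u. map (\<lambda>v. {u, v} \<in> edges (draw \<phi> (set xs) a)) (map \<phi> xs)) (map \<phi> xs)
      = map (\<lambda>x. map (a x) xs) xs"
    using edge_draw_iff[OF assms] by (simp add: o_def)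
  then show ?thesis
    unfolding encode_graph_def by (simp only: length_map)
qed

lemma simple_graph_edge_neq:
  assumes "simple_graph G" "{x, y} \<in> edges G"
  shows "x \<noteq> y"
  using assms by (auto simp: simple_graph_def)

lemma triangleE:
  assumes "T \<in> triangles G"
  obtains x y z where "T = {x, y, z}" "x \<in> verts G" "y \<in> verts G" "z \<in> verts G"
    "{x, y} \<in> edges G" "{y, z} \<in> edges G" "{x, z} \<in> edges G"
proof -
  from assms obtain x y z where "T = {x, y, z}" "x \<noteq> y" "y \<noteq> z" "x \<noteq> z" and "clique G T"
    by (auto simp: triangles_def card_3_iff)
  then show thesis
    using that[of x y z] by (simp add: clique_def)
qed

lemma triangleI:
  assumes "simple_graph G" "x \<in> verts G" "y \<in> verts G" "z \<in> verts G"
    and e: "{x, y} \<in> edges G" "{y, z} \<in> edges G" "{x, z} \<in> edges G"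
  shows "{x, y, z} \<in> triangles G"
proof -
  have "x \<noteq> y" "y \<noteq> z" "x \<noteq> z"
    using e simple_graph_edge_neq[OF assms(1)] by blast+
  then show ?thesis
    using assms by (auto simp: triangles_def clique_def insert_commute)
qed

text \<open>
  Every edge of a 4-clique lies in a triangle inside that clique, and a triangle of \<open>H\<close> brings its
  vertices and edges along to \<open>G\<close>. So the 4-clique would be one of \<open>G\<close>.
\<close>

lemma K4_free_if_same_triangles:
  assumes same: "triangles H = triangles G" and "K4_free G"
  shows "K4_free H"
  unfolding K4_free_def
proof
  assume "\<exists>S. clique H S \<and> card S = 4"
  then obtain S where S: "clique H S" "card S = 4"
    by blast
  have pair: "u \<in> verts G \<and> {u, v} \<in> edges G" if "u \<in> S" "v \<in> S" "u \<noteq> v" for u v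
  proof -
    have "finite S"
      using S(2) card.infinite by fastforce
    then have "\<not> S \<subseteq> {u, v}"
      using S(2) card_mono[of "{u, v}" S] that(3) by auto
    then obtain w where w: "w \<in> S" "w \<noteq> u" "w \<noteq> v"
      by blast
    then have "{u, v, w} \<in> triangles H"
      using S(1) that by (auto simp: triangles_def clique_def)
    then show ?thesis
      unfolding same using that by (auto simp: triangles_def clique_def)
  qed
  have "u \<in> verts G" if "u \<in> S" for u
  proof -
    have "\<not> S \<subseteq> {u}"
      using S(2) card_mono[of "{u}" S] by auto
    then show ?thesis
      using pair that by blast
  qed
  then have "clique G S"
    using pair by (auto simp: clique_def)
  then show False
    using S(2) \<open>K4_free G\<close> by (auto simp: K4_free_def)
qed

section \<open>A triangle-free circulant graph and bipartite fibres\<close>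

definition gap :: "nat \<Rightarrow> nat \<Rightarrow> nat" where
  "gap a b = (a - b) + (b - a)"

text \<open>
  On \<open>{..<6p + 3}\<close> this is the circulant graph with connection set \<open>C = {2p + 2, \<dots>, 4p + 1}\<close>, which
  lies in the middle third of the residues modulo \<open>6p + 3\<close>. As \<open>C = - C\<close> modulo \<open>6p + 3\<close>, the distance of two
  representatives decides adjacency and no reduction is needed.
\<close>

definition circ :: "nat \<Rightarrow> nat \<Rightarrow> nat \<Rightarrow> bool" where
  "circ p a b \<longleftrightarrow> 2 * p + 2 \<le> gap a b \<and> gap a b < 4 * p + 2"

lemma circ_iff: "circ p a b \<longleftrightarrow>
    a + 2 * p + 2 \<le> b \<and> b < a + 4 * p + 2 \<or> b + 2 * p + 2 \<le> a \<and> a < b + 4 * p + 2"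
  unfolding circ_def gap_def by linarith

text \<open>
  Of three numbers, the largest distance is the sum of the other two; two distances of at least
  \<open>2p + 2\<close> add up to more than \<open>4p + 1\<close>.
\<close>

lemma circ_no_triangle: "\<not> (circ p a b \<and> circ p b c \<and> circ p a c)"
  unfolding circ_iff by auto

lemma card_circ:
  assumes "a < 6 * p + 3"
  shows "card {b. b < 6 * p + 3 \<and> circ p a b} = 2 * p"
proof -
  (* The neighbours below and above a. Truncated subtraction cuts the lower interval at 0 and the
     minimum cuts the upper one at the order; what one side loses the other side gains. *)
  have "{b. b < 6 * p + 3 \<and> circ p a b} =
      {a - (4 * p + 1)..<a - (2 * p + 1)} \<union> {a + 2 * p + 2..<min (6 * p + 3) (a + 4 * p + 2)}"
    using assms by (auto simp: circ_iff)
  moreover have "card \<dots> = (a - (2 * p + 1) - (a - (4 * p + 1))) +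
      (min (6 * p + 3) (a + 4 * p + 2) - (a + 2 * p + 2))"
    by (subst card_Un_disjoint) auto
  moreover have "\<dots> = 2 * p"
    using assms by (cases "a < 2 * p + 2"; cases "a \<le> 4 * p"; auto simp: min_def)
  ultimately show ?thesis
    by simp
qed

text \<open>
  A bipartite graph between \<open>{..<d}\<close> and \<open>{d..<2d}\<close>: for \<open>i, b < d\<close> and \<open>r \<le> d\<close>, sheet \<open>i\<close> is joined to sheet
  \<open>d + b\<close> iff \<open>b - i\<close> modulo \<open>d\<close> is less than \<open>r\<close>. Both representatives of that residue are covered by
  the two ranges of the distance: a distance in \<open>[0, r)\<close> means \<open>b < i\<close>, one in \<open>[d, d + r)\<close>
  means \<open>i \<le> b\<close>.
\<close>

definition fibre :: "nat \<Rightarrow> nat \<Rightarrow> nat \<Rightarrow> nat \<Rightarrow> bool" where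
  "fibre d r i j \<longleftrightarrow> (i < d \<and> d \<le> j \<or> j < d \<and> d \<le> i) \<and>
     (gap i j < r \<or> d \<le> gap i j \<and> gap i j < d + r)"

lemma fibre_commute: "fibre d r i j \<longleftrightarrow> fibre d r j i"
  by (auto simp: fibre_def gap_def add.commute)

lemma fibre_bipartite: "fibre d r i j \<Longrightarrow> i < d \<longleftrightarrow> \<not> j < d"
  by (auto simp: fibre_def)

lemma fibre_below_iff:
  assumes "i < d"
  shows "fibre d r i j \<longleftrightarrow> d \<le> j \<and> (j < i + r \<or> d + i \<le> j \<and> j < d + i + r)"
  using assms by (auto simp: fibre_def gap_def)

lemma fibre_above_iff:
  assumes "d \<le> i"
  shows "fibre d r i j \<longleftrightarrow> j < d \<and> (i < j + r \<or> d + j \<le> i \<and> i < d + j + r)"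
  using assms by (auto simp: fibre_def gap_def)

text \<open>
  The neighbours form a cyclic interval of length \<open>r\<close> on the opposite side, which is the union of two
  ordinary intervals, one of them possibly empty.
\<close>

lemma card_fibre:
  assumes "i < 2 * d" "r \<le> d"
  shows "card {j. j < 2 * d \<and> fibre d r i j} = r"
proof (cases "i < d")
  case True
  have "{j. j < 2 * d \<and> fibre d r i j} = {d..<i + r} \<union> {d + i..<min (2 * d) (d + i + r)}"
    using True assms by (auto simp: fibre_below_iff)
  moreover have "card \<dots> = (i + r - d) + (min (2 * d) (d + i + r) - (d + i))"
    using assms by (subst card_Un_disjoint) auto
  moreover have "\<dots> = r"
    using True assms by (cases "i + r \<le> d") (auto simp: min_def)
  ultimately show ?thesis
    by simp
next
  case False
  have "{j. j < 2 * d \<and> fibre d r i j} = {i + 1 - r..<d} \<union> {i + 1 - (d + r)..<i + 1 - d}"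
    using False assms by (auto simp: fibre_above_iff)
  moreover have "card \<dots> = (d - (i + 1 - r)) + (i + 1 - d - (i + 1 - (d + r)))"
    using assms by (subst card_Un_disjoint) auto
  moreover have "\<dots> = r"
    using False assms by (cases "d + r \<le> i + 1") auto
  ultimately show ?thesis
    by simp
qed

section \<open>The permutation of the sheets\<close>

text \<open>
  The graph of the permutation of \<open>{..<m}\<close> that fixes \<open>0\<close> and rotates \<open>1, \<dots>, m - 1\<close> cyclically. As a
  relation it is directly a guard for the program, and the converse permutation needs no
  formula of its own.
\<close>

definition step :: "nat \<Rightarrow> nat \<Rightarrow> nat \<Rightarrow> bool" where
  "step m i j \<longleftrightarrow> i = 0 \<and> j = 0 \<or> i \<noteq> 0 \<and> j = i + 1 \<or> i + 1 = m \<and> j = 1"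

lemma step_right_unique: "step m i j \<Longrightarrow> step m i j' \<Longrightarrow> j < m \<Longrightarrow> j' < m \<Longrightarrow> j = j'"
  by (auto simp: step_def)

lemma step_left_unique: "step m i j \<Longrightarrow> step m i' j \<Longrightarrow> i < m \<Longrightarrow> i' < m \<Longrightarrow> j < m \<Longrightarrow> i = i'"
  by (auto simp: step_def)

lemma step_total:
  assumes "i < m"
  shows "\<exists>j<m. step m i j"
proof (cases "i = 0 \<or> i + 1 = m")
  case True
  then show ?thesis using assms by (intro exI[of _ "if i = 0 then 0 else 1"]) (auto simp: step_def)
next
  case False
  then show ?thesis using assms by (intro exI[of _ "i + 1"]) (auto simp: step_def)
qed

lemma step_surj:
  assumes "j < m"
  shows "\<exists>i<m. step m i j"
proof (cases "j = 1")
  case True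
  then show ?thesis using assms by (intro exI[of _ "m - 1"]) (auto simp: step_def)
next
  case False
  then show ?thesis using assms by (intro exI[of _ "j - 1"]) (auto simp: step_def)
qed

text \<open>
  The hypotheses say \<open>j = \<pi> i\<close> and \<open>k = \<pi> j = \<pi> i\<close>, so \<open>j\<close> is a fixed point and hence \<open>0\<close>. For \<open>m = 2\<close>
  the rotation of \<open>{1}\<close> would provide a second fixed point.
\<close>

lemma step_triangle:
  assumes "step m i j" "step m j k" "step m i k" "i < m" "j < m" "k < m" "m \<noteq> 2"
  shows "i = 0 \<and> j = 0 \<and> k = 0"
  using assms by (auto simp: step_def)

section \<open>The covering, its fibres and the tail\<close>

definition row_degree :: "nat \<Rightarrow> (nat \<Rightarrow> nat \<Rightarrow> bool) \<Rightarrow> nat \<Rightarrow> nat" where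
  "row_degree n B u = card {v. v < n \<and> B u v}"

text \<open>
  Vertex \<open>Inl (i, u)\<close> is the lift of vertex number \<open>u\<close> to sheet \<open>i\<close>; the vertices \<open>Inr a\<close> form the
  tail. \<open>B\<close> is the adjacency matrix of \<open>X\<close>.
\<close>

fun lifted :: "nat \<Rightarrow> (nat \<Rightarrow> nat \<Rightarrow> bool) \<Rightarrow> (nat \<times> nat) + nat \<Rightarrow> (nat \<times> nat) + nat \<Rightarrow> bool" where
  "lifted p B (Inl (i, u)) (Inl (j, v)) \<longleftrightarrow>
     B u v \<and> (u < v \<and> step (4 * p) i j \<or> v < u \<and> step (4 * p) j i) \<or>
     u = v \<and> fibre (2 * p) (2 * p - row_degree (3 * p) B u) i j"
| "lifted p B (Inr a) (Inr b) \<longleftrightarrow> circ p a b"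
| "lifted p B (Inl _) (Inr _) \<longleftrightarrow> False"
| "lifted p B (Inr _) (Inl _) \<longleftrightarrow> False"

definition lifted_verts :: "nat \<Rightarrow> ((nat \<times> nat) + nat) set" where
  "lifted_verts p = Inl ` ({..<4 * p} \<times> {..<3 * p}) \<union> Inr ` {..<6 * p + 3}"

locale base_adjacency =
  fixes p :: nat and B :: "nat \<Rightarrow> nat \<Rightarrow> bool"
  assumes symp_B: "symp B" and irreflp_B: "irreflp B"
    and row_degree_le: "u < 3 * p \<Longrightarrow> row_degree (3 * p) B u \<le> 2 * p"
begin

lemma symp_lifted: "symp (lifted p B)"
proof (rule sympI)
  show "lifted p B y x" if "lifted p B x y" for x y
    using that symp_B by (cases "(p, B, x, y)" rule: lifted.cases) (auto simp: fibre_commute circ_iff dest: sympD)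
qed

lemma irreflp_lifted: "irreflp (lifted p B)"
proof (rule irreflpI)
  show "\<not> lifted p B x x" for x
    by (cases "(p, B, x, x)" rule: lifted.cases) (auto simp: circ_iff fibre_def)
qed

lemma lifted_sheet_0: "lifted p B (Inl (0, u)) (Inl (0, v)) \<longleftrightarrow> B u v"
  using irreflp_B by (cases u v rule: linorder_cases) (auto simp: step_def fibre_def irreflp_def)

text \<open>
  Edges of the covering connect different base vertices, fibre edges connect equal ones. If two
  corners of a triangle lie over the same base vertex, the edge between them is a fibre edge, and the
  third corner either lies in the same bipartite fibre or is adjacent in the covering to two lifts
  of one vertex. Otherwise all three edges belong to the covering, and sorting the corners by their
  base vertices leads to \<open>step_triangle\<close>.
\<close>

lemma lifted_triangle:
  assumes "x \<in> lifted_verts p" "y \<in> lifted_verts p" "z \<in> lifted_verts p"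
    and "lifted p B x y" "lifted p B y z" "lifted p B x z"
  obtains u v w where "x = Inl (0, u)" "y = Inl (0, v)" "z = Inl (0, w)"
proof (cases x)
  case (Inr a)
  then obtain b c where "y = Inr b" "z = Inr c"
    using assms(4,6) by (cases y; cases z) auto
  then show ?thesis
    using assms(4-6) Inr circ_no_triangle[of p a b c] by auto
next
  case (Inl iu)
  then obtain i u j v k w where eq: "x = Inl (i, u)" "y = Inl (j, v)" "z = Inl (k, w)"
    using assms(4,6) by (cases iu; cases y; cases z) auto
  let ?m = "4 * p"
  have lt: "i < ?m" "j < ?m" "k < ?m"
    using assms(1-3) eq by (auto simp: lifted_verts_def)
  define hor where "hor = (\<lambda>i (u::nat) j v. u < v \<and> step ?m i j \<or> v < u \<and> step ?m j i)"
  define ver where "ver = (\<lambda>i (u::nat) j v. u = v \<and> (i < 2 * p \<longleftrightarrow> \<not> j < 2 * p))"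
  have edges: "hor i u j v \<or> ver i u j v" "hor j v k w \<or> ver j v k w" "hor i u k w \<or> ver i u k w"
    using assms(4-6) by (auto simp: eq hor_def ver_def dest: fibre_bipartite)
  (* No covering edges from (k, w) to two lifts (i, u) and (j, u) on different sides of the fibre. *)
  have no_ver: False if "hor i u k w" "hor j u k w" "i < ?m" "j < ?m" "k < ?m" "i < 2 * p \<longleftrightarrow> \<not> j < 2 * p" for i u j k w
    using that step_left_unique[of ?m i k j] step_right_unique[of ?m k i j] by (auto simp: hor_def)
  have hor_sym: "hor i u j v \<Longrightarrow> hor j v i u" for i u j v
    by (auto simp: hor_def)
  have "u \<noteq> v"
  proof
    assume "u = v"
    then have "ver i u j v" using edges by (auto simp: hor_def)
    then show False using edges no_ver[of i u k w j] lt \<open>u = v\<close> by (auto simp: ver_def hor_def)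
  qed
  moreover have "v \<noteq> w"
  proof
    assume "v = w"
    then have "ver j v k w" using edges by (auto simp: hor_def)
    then show False using edges no_ver[of j v i u k] hor_sym lt \<open>v = w\<close> \<open>u \<noteq> v\<close> by (auto simp: ver_def)
  qed
  moreover have "u \<noteq> w"
  proof
    assume "u = w"
    then have "ver i u k w" using edges by (auto simp: hor_def)
    then show False using edges no_ver[of i u j v k] hor_sym lt \<open>u = w\<close> \<open>u \<noteq> v\<close> by (auto simp: ver_def)
  qed
  ultimately have h: "hor i u j v" "hor j v k w" "hor i u k w"
    using edges by (auto simp: ver_def)
  have "?m \<noteq> 2" by presburger
  then have sorted: "a = 0 \<and> b = 0 \<and> c = 0"
    if "hor a u' b v'" "hor b v' c w'" "hor a u' c w'" "u' < v'" "v' < w'" "a < ?m" "b < ?m" "c < ?m"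
    for a b c u' v' w'
    using step_triangle[of ?m a b c] that by (simp add: hor_def)
  consider "u < v" "v < w" | "u < w" "w < v" | "v < u" "u < w" | "v < w" "w < u" | "w < u" "u < v" | "w < v" "v < u"
    using \<open>u \<noteq> v\<close> \<open>v \<noteq> w\<close> \<open>u \<noteq> w\<close> by linarith
  then have "i = 0 \<and> j = 0 \<and> k = 0"
    using h h[THEN hor_sym] lt by cases (blast dest: sorted)+
  then show ?thesis
    using that eq by blast
qed

text \<open>
  A lift of \<open>u\<close> has one neighbour over each neighbour of \<open>u\<close>, because \<open>step\<close> is a permutation, and the
  degree of the fibre graph was chosen as the remaining deficiency.
\<close>

lemma lifted_regular:
  assumes "x \<in> lifted_verts p"
  shows "card {y \<in> lifted_verts p. lifted p B x y} = 2 * p"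
proof (cases x)
  case (Inr a)
  then have "{y \<in> lifted_verts p. lifted p B x y} = Inr ` {b. b < 6 * p + 3 \<and> circ p a b}"
    by (auto simp: lifted_verts_def)
  then show ?thesis
    using card_circ[of a p] assms Inr by (auto simp: card_image lifted_verts_def)
next
  case (Inl iu)
  then obtain i u where x: "x = Inl (i, u)"
    by (cases iu) auto
  let ?m = "4 * p" and ?r = "2 * p - row_degree (3 * p) B u"
  have iu: "i < ?m" "u < 3 * p"
    using assms x by (auto simp: lifted_verts_def)
  have "\<exists>j<?m. u < v \<and> step ?m i j \<or> v < u \<and> step ?m j i" if "v \<noteq> u" for v
    using step_total[OF iu(1)] step_surj[OF iu(1)] that by (meson linorder_neqE_nat)
  (* nb v is the sheet on which (i, u) meets the fibre over v: the image of i under the permutation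
     if u < v, the preimage if v < u. *)
  then obtain nb where nb: "\<And>v. v \<noteq> u \<Longrightarrow> nb v < ?m \<and> (u < v \<and> step ?m i (nb v) \<or> v < u \<and> step ?m (nb v) i)"
    by metis
  have nb_unique: "j = nb v" if "u < v \<and> step ?m i j \<or> v < u \<and> step ?m j i" "j < ?m" for j v
    using nb[of v] that step_right_unique[of ?m i j "nb v"] step_left_unique[of ?m j i "nb v"] iu(1) by auto
  have irr: "\<not> B u u"
    using irreflp_B by (auto simp: irreflp_def)
  define hor where "hor = (\<lambda>v. (nb v, v)) ` {v. v < 3 * p \<and> B u v}"
  define ver where "ver = (\<lambda>j. (j, u)) ` {j. j < ?m \<and> fibre (2 * p) ?r i j}"
  have "{y \<in> lifted_verts p. lifted p B x y} = Inl ` (hor \<union> ver)"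
  proof (intro set_eqI iffI)
    fix y :: "(nat \<times> nat) + nat"
    assume "y \<in> {y \<in> lifted_verts p. lifted p B x y}"
    then show "y \<in> Inl ` (hor \<union> ver)"
      using nb_unique by (cases y) (auto simp: x lifted_verts_def hor_def ver_def image_iff)
  next
    fix y :: "(nat \<times> nat) + nat"
    assume "y \<in> Inl ` (hor \<union> ver)"
    then consider v where "y = Inl (nb v, v)" "v < 3 * p" "B u v" "v \<noteq> u"
      | j where "y = Inl (j, u)" "j < ?m" "fibre (2 * p) ?r i j"
      using irr by (auto simp: hor_def ver_def)
    then show "y \<in> {y \<in> lifted_verts p. lifted p B x y}"
      using nb iu by cases (auto simp: x lifted_verts_def)
  qed
  moreover have "card (Inl ` (hor \<union> ver) :: ((nat \<times> nat) + nat) set) = card hor + card ver"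
    using irr by (subst card_image, simp, subst card_Un_disjoint) (auto simp: hor_def ver_def)
  moreover have "card hor = row_degree (3 * p) B u"
    unfolding hor_def row_degree_def by (rule card_image) (auto intro: inj_onI)
  moreover have "card ver = ?r"
    unfolding ver_def using card_fibre[of i "2 * p" ?r] iu by (subst card_image) (auto intro: inj_onI)
  ultimately show ?thesis
    using row_degree_le[OF iu(2)] by simp
qed

end

section \<open>The regular graph that contains a given graph\<close>

text \<open>
  Sheet by sheet, so that the list starts with sheet \<open>0\<close>, the copy of \<open>X\<close>.
\<close>

definition lifted_list :: "nat \<Rightarrow> ((nat \<times> nat) + nat) list" where
  "lifted_list p = map Inl (List.product [0..<4 * p] [0..<3 * p]) @ map Inr [0..<6 * p + 3]"

lemma set_lifted_list: "set (lifted_list p) = lifted_verts p"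
  by (auto simp: lifted_list_def lifted_verts_def)

lemma distinct_lifted_list: "distinct (lifted_list p)"
  by (auto simp: lifted_list_def distinct_map distinct_product)

lemma length_lifted_list: "length (lifted_list p) = 4 * p * (3 * p) + (6 * p + 3)"
  by (simp add: lifted_list_def length_product)

lemma lifted_list_sheet_0: "\<exists>xs. lifted_list p = map (\<lambda>u. Inl (0, u)) [0..<3 * p] @ xs"
proof (cases p)
  case (Suc q)
  then have "[0..<4 * p] = 0 # [1..<4 * p]"
    by (simp add: upt_conv_Cons)
  then show ?thesis
    by (simp add: lifted_list_def)
qed (simp add: lifted_list_def)

text \<open>
  The word that encodes the drawn graph. The names of the vertices do not enter, so it can be computed
  from the adjacency matrix of \<open>X\<close>.
\<close>

definition lifted_word :: "nat \<Rightarrow> (nat \<Rightarrow> nat \<Rightarrow> bool) \<Rightarrow> bool list" where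
  "lifted_word p B = replicate (length (lifted_list p)) True @ [False] @
     concat (map (\<lambda>x. map (lifted p B x) (lifted_list p)) (lifted_list p))"

lemma lifted_word_cong:
  assumes "\<And>u v. u < 3 * p \<Longrightarrow> v < 3 * p \<Longrightarrow> B u v = B' u v"
  shows "lifted_word p B = lifted_word p B'"
proof -
  have deg: "row_degree (3 * p) B u = row_degree (3 * p) B' u" if "u < 3 * p" for u
    unfolding row_degree_def using assms that by (intro arg_cong[of _ _ card]) auto
  have "lifted p B x y = lifted p B' x y" if "x \<in> lifted_verts p" "y \<in> lifted_verts p" for x y
    using that assms deg by (cases "(p, B, x, y)" rule: lifted.cases) (auto simp: lifted_verts_def)
  then have "map (\<lambda>x. map (lifted p B x) (lifted_list p)) (lifted_list p) =
      map (\<lambda>x. map (lifted p B' x) (lifted_list p)) (lifted_list p)"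
    by (simp add: set_lifted_list)
  then show ?thesis
    by (simp only: lifted_word_def)
qed

definition adjacency :: "'a list \<Rightarrow> 'a ugraph \<Rightarrow> nat \<Rightarrow> nat \<Rightarrow> bool" where
  "adjacency vs X u v \<longleftrightarrow> {vs ! u, vs ! v} \<in> edges X"

lemma symp_adjacency: "symp (adjacency vs X)"
  by (auto simp: adjacency_def insert_commute intro: sympI)

lemma irreflp_adjacency: "simple_graph X \<Longrightarrow> irreflp (adjacency vs X)"
  by (metis adjacency_def irreflpI simple_graph_edge_neq)

text \<open>
  This identifies the degrees of \<open>X\<close> with row sums of its matrix, by way of \<open>vertex_degree_draw\<close>.
\<close>

lemma graph_eq_draw:
  assumes "simple_graph X" "enumerates vs X"
  shows "X = draw ((!) vs) {..<length vs} (adjacency vs X)"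
proof -
  have vs: "verts X = (!) vs ` {..<length vs}"
    using assms(2) by (auto simp: enumerates_def set_conv_nth)
  have "e \<in> {{vs ! u, vs ! v} |u v. u \<in> {..<length vs} \<and> v \<in> {..<length vs} \<and> adjacency vs X u v}"
    if "e \<in> edges X" for e
  proof -
    have "e \<subseteq> verts X" "card e = 2"
      using assms(1) that by (auto simp: simple_graph_def)
    then obtain x y where "e = {x, y}" "x \<in> verts X" "y \<in> verts X"
      by (auto simp: card_2_iff)
    then show ?thesis
      using that unfolding vs adjacency_def by blast
  qed
  then have "edges X = {{vs ! u, vs ! v} |u v. u \<in> {..<length vs} \<and> v \<in> {..<length vs} \<and> adjacency vs X u v}"
    by (auto simp: adjacency_def)
  then show ?thesis
    using vs by (simp add: draw_def)
qed

lemma row_degree_adjacency: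
  assumes "simple_graph X" "enumerates vs X" "u < length vs"
  shows "row_degree (length vs) (adjacency vs X) u = vertex_degree X (vs ! u)"
proof -
  have "inj_on ((!) vs) {..<length vs}"
    using assms(2) by (auto simp: enumerates_def inj_on_def nth_eq_iff_index_eq)
  then have "vertex_degree (draw ((!) vs) {..<length vs} (adjacency vs X)) (vs ! u) =
      card {v \<in> {..<length vs}. adjacency vs X u v}"
    using symp_adjacency assms(3) by (intro vertex_degree_draw) auto
  then show ?thesis
    using graph_eq_draw[OF assms(1,2)] by (simp add: row_degree_def)
qed

lemma vertex_degree_le_max_degree:
  "simple_graph X \<Longrightarrow> v \<in> verts X \<Longrightarrow> vertex_degree X v \<le> max_degree X"
  by (auto simp: max_degree_def simple_graph_def intro!: Max_ge)

text \<open>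
  Sheet \<open>0\<close> is placed on the vertices of \<open>X\<close> themselves. Every other vertex receives a number above
  the sum of the list, thus above all vertices of \<open>X\<close>.
\<close>

fun embed :: "nat list \<Rightarrow> (nat \<times> nat) + nat \<Rightarrow> nat" where
  "embed vs (Inl (0, u)) = vs ! u"
| "embed vs x = Suc (sum_list vs) + to_nat x"

lemma inj_on_embed:
  assumes "distinct vs" "length vs = 3 * p"
  shows "inj_on (embed vs) (lifted_verts p)"
proof -
  have less: "vs ! u < Suc (sum_list vs)" if "u < 3 * p" for u
    using that assms(2) member_le_sum_list[of "vs ! u" vs] by (simp add: less_Suc_eq_le)
  show ?thesis
  proof (rule inj_onI)
    fix x y assume xy: "x \<in> lifted_verts p" "y \<in> lifted_verts p" "embed vs x = embed vs y"
    show "x = y"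
      using xy assms less
      by (cases "(vs, x)" rule: embed.cases; cases "(vs, y)" rule: embed.cases;
          auto simp: lifted_verts_def nth_eq_iff_index_eq; metis add_Suc not_add_less1)
  qed
qed

lemma regular_supergraph:
  fixes X :: "nat ugraph"
  assumes X: "simple_graph X" and vs: "enumerates vs X" and K4: "K4_free X"
    and card: "card (verts X) = 3 * p" and deg: "max_degree X \<le> 2 * p"
  defines "H \<equiv> draw (embed vs) (lifted_verts p) (lifted p (adjacency vs X))"
  shows "simple_graph H" "verts X \<subseteq> verts H" "regular (2 * p) H" "triangles H = triangles X" "K4_free H"
    "card (verts H) = 4 * p * (3 * p) + (6 * p + 3)"
    "\<exists>ws. enumerates (vs @ ws) H \<and> encode_graph (vs @ ws) H = lifted_word p (adjacency vs X)"
proof -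
  let ?B = "adjacency vs X" and ?V = "lifted_verts p"
  have len: "length vs = 3 * p" and dist: "distinct vs" and set_vs: "set vs = verts X"
    using vs card distinct_card[of vs] by (auto simp: enumerates_def)
  interpret base_adjacency p ?B
  proof
    show "row_degree (3 * p) ?B u \<le> 2 * p" if "u < 3 * p" for u
      using row_degree_adjacency[OF X vs, of u] vertex_degree_le_max_degree[OF X, of "vs ! u"]
        that len deg set_vs nth_mem[of u vs] by simp
  qed (rule symp_adjacency irreflp_adjacency[OF X])+
  note inj = inj_on_embed[OF dist len]
  have fin: "finite ?V"
    by (simp add: lifted_verts_def)
  show simple: "simple_graph H"
    unfolding H_def by (rule simple_graph_draw[OF fin inj irreflp_lifted])
  have edge_iff: "{embed vs x, embed vs y} \<in> edges H \<longleftrightarrow> lifted p ?B x y" if "x \<in> ?V" "y \<in> ?V" for x y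
    unfolding H_def using edge_draw_iff[OF inj symp_lifted that] .
  have sheet_0: "Inl (0, u) \<in> ?V" if "u < 3 * p" for u
    using that by (auto simp: lifted_verts_def)
  have edge_sheet_0: "{vs ! u, vs ! v} \<in> edges H \<longleftrightarrow> {vs ! u, vs ! v} \<in> edges X"
    if "u < 3 * p" "v < 3 * p" for u v
    using edge_iff[OF sheet_0 sheet_0, OF that] unfolding lifted_sheet_0 by (simp add: adjacency_def)
  have nth_ex: "\<exists>u<3 * p. x = vs ! u" if "x \<in> verts X" for x
    using that set_vs len by (metis in_set_conv_nth)
  show sub: "verts X \<subseteq> verts H"
  proof
    fix x assume "x \<in> verts X"
    then obtain u where "u < 3 * p" "x = embed vs (Inl (0, u))"
      using nth_ex by fastforce
    then show "x \<in> verts H"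
      unfolding H_def verts_draw using sheet_0 by blast
  qed
  show "regular (2 * p) H"
    using vertex_degree_draw[OF inj symp_lifted] lifted_regular
    by (auto simp: H_def regular_def)
  show tri: "triangles H = triangles X"
  proof (intro set_eqI iffI)
    fix T assume "T \<in> triangles H"
    then obtain a b c where T: "T = {a, b, c}" and verts: "a \<in> verts H" "b \<in> verts H" "c \<in> verts H"
      and edges: "{a, b} \<in> edges H" "{b, c} \<in> edges H" "{a, c} \<in> edges H"
      by (rule triangleE)
    obtain x y z where xyz: "a = embed vs x" "b = embed vs y" "c = embed vs z"
        and in_V: "x \<in> ?V" "y \<in> ?V" "z \<in> ?V"
      using verts by (auto simp: H_def)
    have adj: "lifted p ?B x y" "lifted p ?B y z" "lifted p ?B x z"
      using edges edge_iff in_V unfolding xyz by simp_all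
    obtain u v w where uvw: "x = Inl (0, u)" "y = Inl (0, v)" "z = Inl (0, w)"
      using in_V adj by (rule lifted_triangle)
    then have lt: "u < 3 * p" "v < 3 * p" "w < 3 * p"
      using in_V by (auto simp: lifted_verts_def)
    then have "vs ! u \<in> verts X" "vs ! v \<in> verts X" "vs ! w \<in> verts X"
      using len by (simp_all flip: set_vs)
    moreover have "{vs ! u, vs ! v} \<in> edges X" "{vs ! v, vs ! w} \<in> edges X" "{vs ! u, vs ! w} \<in> edges X"
      using edges edge_sheet_0 lt by (simp_all add: xyz uvw)
    ultimately show "T \<in> triangles X"
      unfolding T xyz uvw embed.simps by (rule triangleI[OF X])
  next
    fix T assume "T \<in> triangles X"
    then obtain a b c where T: "T = {a, b, c}" and verts: "a \<in> verts X" "b \<in> verts X" "c \<in> verts X"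
      and edges: "{a, b} \<in> edges X" "{b, c} \<in> edges X" "{a, c} \<in> edges X"
      by (rule triangleE)
    have "{a, b} \<in> edges H" "{b, c} \<in> edges H" "{a, c} \<in> edges H"
      using edges edge_sheet_0 verts[THEN nth_ex] by metis+
    then show "T \<in> triangles H"
      unfolding T using verts sub by (intro triangleI[OF simple]) auto
  qed
  show "K4_free H"
    by (rule K4_free_if_same_triangles[OF tri K4])
  have "card (verts H) = length (lifted_list p)"
    using distinct_card[OF distinct_lifted_list, of p] card_image[OF inj] by (simp add: H_def set_lifted_list)
  then show "card (verts H) = 4 * p * (3 * p) + (6 * p + 3)"
    by (simp only: length_lifted_list)
  obtain xs where xs: "lifted_list p = map (\<lambda>u. Inl (0, u)) [0..<3 * p] @ xs"
    using lifted_list_sheet_0 by blast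
  have "map (\<lambda>u. vs ! u) [0..<3 * p] = vs"
    using map_nth[of vs] len by simp
  then have hs: "map (embed vs) (lifted_list p) = vs @ map (embed vs) xs"
    by (simp add: xs o_def)
  have "enumerates (map (embed vs) (lifted_list p)) H"
    using inj distinct_lifted_list by (simp add: enumerates_def H_def set_lifted_list distinct_map)
  moreover have "encode_graph (map (embed vs) (lifted_list p)) H = lifted_word p ?B"
    unfolding H_def lifted_word_def set_lifted_list[symmetric]
    by (rule encode_graph_draw) (simp_all add: set_lifted_list inj symp_lifted)
  ultimately show "\<exists>ws. enumerates (vs @ ws) H \<and> encode_graph (vs @ ws) H = lifted_word p ?B"
    unfolding hs by blast
qed

section \<open>Reasoning about programs\<close>

text \<open>
  Total correctness with an upper bound on the time. Bounds, unlike the exact times of \<open>exec\<close>, can be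
  the same for all rounds of a loop, so the cost of a loop is a product.
\<close>

definition achieves :: "com \<Rightarrow> state \<Rightarrow> nat \<Rightarrow> (state \<Rightarrow> bool) \<Rightarrow> bool" where
  "achieves c s T Q \<longleftrightarrow> (\<exists>t s'. exec c s t s' \<and> t \<le> T \<and> Q s')"

lemma achieves_weaken: "achieves c s T Q \<Longrightarrow> T \<le> T' \<Longrightarrow> (\<And>s'. Q s' \<Longrightarrow> Q' s') \<Longrightarrow> achieves c s T' Q'"
  unfolding achieves_def by (meson le_trans)

lemma achieves_Assign:
  "Q (s\<lparr>reg := (reg s)(r := aval a s)\<rparr>) \<Longrightarrow> 1 \<le> T \<Longrightarrow> achieves (Assign r a) s T Q"
  unfolding achieves_def using exec.Assign by blast

lemma achieves_Seq:
  assumes "achieves c1 s T1 Q" "\<And>s'. Q s' \<Longrightarrow> achieves c2 s' T2 Q'"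
  shows "achieves (Seq c1 c2) s (T1 + T2) Q'"
  using assms unfolding achieves_def by (meson add_mono exec.Seq)

text \<open>
  The invariant carries the number \<open>k\<close> of rounds done so far, so that the total number \<open>B\<close> of rounds
  bounds the time.
\<close>

lemma achieves_While:
  assumes "I k s" "k \<le> B"
    and guard: "\<And>k s. I k s \<Longrightarrow> aval b s \<noteq> 0 \<longleftrightarrow> k < B"
    and body: "\<And>k s. k < B \<Longrightarrow> I k s \<Longrightarrow> achieves c s T (I (Suc k))"
  shows "achieves (While b c) s ((B - k) * (T + 1) + 1) (I B)"
  using assms(1,2)
proof (induction "B - k" arbitrary: k s)
  case 0
  then show ?case
    using guard[OF 0(2)] exec.WhileFalse[of b s c] by (auto simp: achieves_def)
next
  case (Suc l)
  then have k: "k < B" and l: "l = B - Suc k"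
    by simp_all
  obtain t s' where t: "exec c s t s'" "t \<le> T" "I (Suc k) s'"
    using body[OF k Suc.prems(1)] by (auto simp: achieves_def)
  obtain t' s'' where t': "exec (While b c) s' t' s''" "t' \<le> l * (T + 1) + 1" "I B s''"
    using Suc.hyps(1)[OF l t(3)] k unfolding l achieves_def by auto
  have "exec (While b c) s (1 + t + t') s''"
    using guard[OF Suc.prems(1)] k t(1) t'(1) by (intro exec.WhileTrue) auto
  moreover have "1 + t + t' \<le> (B - k) * (T + 1) + 1"
    using t(2) t'(2) by (simp flip: Suc.hyps(2))
  ultimately show ?case
    using t'(3) by (auto simp: achieves_def)
qed

definition For :: "nat \<Rightarrow> aexp \<Rightarrow> com \<Rightarrow> com" where
  "For r b c = Seq (Assign r (Const 0))
     (While (Sub b (Reg r)) (Seq c (Assign r (Add (Reg r) (Const 1)))))"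

text \<open>
  Bounds the time of a loop with at most \<open>K\<close> rounds of time \<open>T\<close>; one test and one increment are
  added per round, one assignment and the last test at the end. It is polymorphic so that the same
  expression denotes a number of steps and a polynomial in the input length.
\<close>

definition loop_time :: "'a::comm_semiring_1 \<Rightarrow> 'a \<Rightarrow> 'a" where
  "loop_time K T = K * (T + 2) + 2"

lemma poly_loop_time: "poly (loop_time q t) x = loop_time (poly q x) (poly t x)"
  by (simp add: loop_time_def)

text \<open>
  The actual number \<open>B\<close> of rounds may be replaced by any larger \<open>K\<close>. Using a single \<open>K\<close> for all
  loops keeps the time bound of nested loops an expression in \<open>K\<close> alone.
\<close>

lemma achieves_For:
  assumes init: "I 0 (s\<lparr>reg := (reg s)(r := 0)\<rparr>)"
    and bound: "\<And>k s. I k s \<Longrightarrow> reg s r = k \<Longrightarrow> aval b s = B"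
    and body: "\<And>k s. k < B \<Longrightarrow> I k s \<Longrightarrow> reg s r = k \<Longrightarrow>
      achieves c s T (\<lambda>s'. reg s' r = k \<and> I (Suc k) (s'\<lparr>reg := (reg s')(r := Suc k)\<rparr>))"
    and "B \<le> K"
  shows "achieves (For r b c) s (loop_time K T) (I B)"
proof -
  let ?J = "\<lambda>k s. I k s \<and> reg s r = k"
  have "achieves (Seq c (Assign r (Add (Reg r) (Const 1)))) s' (T + 1) (?J (Suc k))"
    if "k < B" "?J k s'" for k s'
    using that by (intro achieves_Seq[OF body] achieves_Assign) auto
  then have "achieves (While (Sub b (Reg r)) (Seq c (Assign r (Add (Reg r) (Const 1))))) s'
      ((B - 0) * (T + 1 + 1) + 1) (?J B)" if "?J 0 s'" for s'
    using that bound by (intro achieves_While[where I = ?J]) auto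
  then have "achieves (For r b c) s (1 + ((B - 0) * (T + 1 + 1) + 1)) (?J B)"
    unfolding For_def using init by (intro achieves_Seq achieves_Assign) auto
  then show ?thesis
    by (rule achieves_weaken) (use mult_le_mono1[OF \<open>B \<le> K\<close>, of "T + 2"] in \<open>auto simp: loop_time_def\<close>)
qed

text \<open>
  The frame condition of the programs below: they write to no memory cell and to no register outside
  \<open>R\<close>. The output is left to \<open>prints\<close>.
\<close>

definition same_but :: "nat set \<Rightarrow> state \<Rightarrow> state \<Rightarrow> bool" where
  "same_but R s s' \<longleftrightarrow> mem s' = mem s \<and> (\<forall>r. r \<notin> R \<longrightarrow> reg s' r = reg s r)"

lemma same_but_trans: "same_but R s s' \<Longrightarrow> same_but R' s' s'' \<Longrightarrow> R \<union> R' \<subseteq> R'' \<Longrightarrow> same_but R'' s s''"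
  unfolding same_but_def by (metis Un_iff subsetD)

definition prints :: "nat set \<Rightarrow> com \<Rightarrow> state \<Rightarrow> nat \<Rightarrow> bool list \<Rightarrow> bool" where
  "prints R c s T w \<longleftrightarrow> achieves c s T (\<lambda>s'. same_but R s s' \<and> out s' = out s @ w)"

lemma prints_Print: "w = [aval a s \<noteq> 0] \<Longrightarrow> prints R (Print a) s 1 w"
  unfolding prints_def achieves_def same_but_def
  by (rule exI[of _ 1], rule exI[of _ "s\<lparr>out := out s @ [aval a s \<noteq> 0]\<rparr>"]) (simp add: exec.Print[simplified])

lemma prints_Seq:
  assumes "prints R c1 s T1 w1" "\<And>s'. same_but R s s' \<Longrightarrow> prints R c2 s' T2 w2"
  shows "prints R (Seq c1 c2) s (T1 + T2) (w1 @ w2)"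
  unfolding prints_def
proof (rule achieves_Seq[OF assms(1)[unfolded prints_def]])
  fix s' assume s': "same_but R s s' \<and> out s' = out s @ w1"
  then have "achieves c2 s' T2 (\<lambda>s''. same_but R s' s'' \<and> out s'' = out s' @ w2)"
    using assms(2) unfolding prints_def by blast
  then show "achieves c2 s' T2 (\<lambda>s''. same_but R s s'' \<and> out s'' = out s @ w1 @ w2)"
    by (rule achieves_weaken) (use s' in \<open>auto elim: same_but_trans\<close>)
qed

text \<open>
  \<open>prints\<close> says nothing about final register values; here \<open>Q\<close> passes on the values that a silent
  preparation has computed.
\<close>

lemma prints_after:
  assumes "achieves c1 s T1 (\<lambda>s'. same_but R s s' \<and> out s' = out s \<and> Q s')"
    and "\<And>s'. same_but R s s' \<Longrightarrow> Q s' \<Longrightarrow> prints R c2 s' T2 w"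
  shows "prints R (Seq c1 c2) s (T1 + T2) w"
  unfolding prints_def
proof (rule achieves_Seq[OF assms(1)])
  fix s' assume s': "same_but R s s' \<and> out s' = out s \<and> Q s'"
  then have "achieves c2 s' T2 (\<lambda>s''. same_but R s' s'' \<and> out s'' = out s' @ w)"
    using assms(2) unfolding prints_def by blast
  then show "achieves c2 s' T2 (\<lambda>s''. same_but R s s'' \<and> out s'' = out s @ w)"
    by (rule achieves_weaken) (use s' in \<open>auto elim: same_but_trans\<close>)
qed

lemma prints_For:
  assumes bound: "\<And>s'. same_but R s s' \<Longrightarrow> aval b s' = B" and "B \<le> K"
    and body: "\<And>k s'. k < B \<Longrightarrow> same_but R s s' \<Longrightarrow> reg s' r = k \<Longrightarrow> prints (R - {r}) c s' T (g k)"
    and "r \<in> R"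
  shows "prints R (For r b c) s (loop_time K T) (concat (map g [0..<B]))"
  unfolding prints_def
proof (rule achieves_For[where I = "\<lambda>k s'. same_but R s s' \<and> out s' = out s @ concat (map g [0..<k])"])
  fix k s' assume *: "k < B" "same_but R s s' \<and> out s' = out s @ concat (map g [0..<k])" "reg s' r = k"
  have "achieves c s' T (\<lambda>s''. same_but (R - {r}) s' s'' \<and> out s'' = out s' @ g k)"
    using body * unfolding prints_def by blast
  then show "achieves c s' T (\<lambda>s''. reg s'' r = k \<and> same_but R s (s''\<lparr>reg := (reg s'')(r := Suc k)\<rparr>) \<and>
      out (s''\<lparr>reg := (reg s'')(r := Suc k)\<rparr>) = out s @ concat (map g [0..<Suc k]))"
    by (rule achieves_weaken) (use * \<open>r \<in> R\<close> in \<open>auto simp: same_but_def\<close>)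
qed (use assms in \<open>auto simp: same_but_def\<close>)

lemma achieves_sum:
  assumes bound: "\<And>s'. same_but {r, a} s s' \<Longrightarrow> aval b s' = B" and "B \<le> K"
    and summand: "\<And>k s'. k < B \<Longrightarrow> same_but {r, a} s s' \<Longrightarrow> reg s' r = k \<Longrightarrow> aval e s' = g k"
    and "r \<noteq> a" "{r, a} \<subseteq> R"
  shows "achieves (For r b (Assign a (Add (Reg a) e))) s (loop_time K 1)
    (\<lambda>s'. same_but R s s' \<and> out s' = out s \<and> reg s' a = reg s a + (\<Sum>k<B. g k))"
proof -
  have "achieves (For r b (Assign a (Add (Reg a) e))) s (loop_time K 1)
    (\<lambda>s'. same_but {r, a} s s' \<and> out s' = out s \<and> reg s' a = reg s a + (\<Sum>k<B. g k))"
    by (rule achieves_For[where I = "\<lambda>k s'. same_but {r, a} s s' \<and> out s' = out s \<and> reg s' a = reg s a + (\<Sum>i<k. g i)"])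
      (use assms in \<open>auto simp: same_but_def intro!: achieves_Assign\<close>)
  then show ?thesis
    by (rule achieves_weaken) (use \<open>{r, a} \<subseteq> R\<close> in \<open>auto simp: same_but_def\<close>)
qed

lemma prints_grid:
  assumes b1: "\<And>s'. same_but R s s' \<Longrightarrow> aval b1 s' = B1" "B1 \<le> K"
    and b2: "\<And>s'. same_but R s s' \<Longrightarrow> aval b2 s' = B2" "B2 \<le> K"
    and entry: "\<And>i u s'. i < B1 \<Longrightarrow> u < B2 \<Longrightarrow> same_but R s s' \<Longrightarrow> reg s' r1 = i \<Longrightarrow> reg s' r2 = u \<Longrightarrow>
      aval e s' \<noteq> 0 \<longleftrightarrow> g i u"
    and r: "r1 \<noteq> r2" "{r1, r2} \<subseteq> R"
  shows "prints R (For r1 b1 (For r2 b2 (Print e))) s (loop_time K (loop_time K 1))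
    (concat (map (\<lambda>i. concat (map (\<lambda>u. [g i u]) [0..<B2])) [0..<B1]))"
proof (rule prints_For[OF b1])
  fix i s' assume i: "i < B1" "same_but R s s'" "reg s' r1 = i"
  have trans: "same_but R s s''" if "same_but (R - {r1}) s' s''" for s''
    using same_but_trans[OF i(2) that] by blast
  show "prints (R - {r1}) (For r2 b2 (Print e)) s' (loop_time K 1) (concat (map (\<lambda>u. [g i u]) [0..<B2]))"
  proof (rule prints_For[OF b2(1)[OF trans] b2(2)])
    fix u s'' assume u: "u < B2" "same_but (R - {r1}) s' s''" "reg s'' r2 = u"
    then have "reg s'' r1 = i"
      using i(3) by (simp add: same_but_def)
    then show "prints (R - {r1} - {r2}) (Print e) s'' 1 [g i u]"
      using entry[OF i(1) u(1) trans[OF u(2)]] u(3) by (intro prints_Print) simp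
  qed (use r in auto)
qed (use r in auto)

lemma prints_row:
  assumes "\<And>s'. same_but R s s' \<Longrightarrow> aval b s' = B" "B \<le> K"
    and "\<And>k s'. k < B \<Longrightarrow> same_but R s s' \<Longrightarrow> reg s' r = k \<Longrightarrow> aval e s' \<noteq> 0 \<longleftrightarrow> g k"
    and "r \<in> R"
  shows "prints R (For r b (Print e)) s (loop_time K 1) (concat (map (\<lambda>k. [g k]) [0..<B]))"
  using assms by (intro prints_For prints_Print) auto

definition Inc_while :: "aexp \<Rightarrow> nat \<Rightarrow> com" where
  "Inc_while b r = While b (Assign r (Add (Reg r) (Const 1)))"

lemma achieves_Inc_while:
  assumes "reg s r = 0" "B \<le> K" "\<And>k s'. k \<le> B \<Longrightarrow> same_but {r} s s' \<Longrightarrow> reg s' r = k \<Longrightarrow> aval b s' \<noteq> 0 \<longleftrightarrow> k < B"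
  shows "achieves (Inc_while b r) s (K * 2 + 1) (\<lambda>s'. same_but {r} s s' \<and> out s' = out s \<and> reg s' r = B)"
proof -
  have "achieves (Inc_while b r) s ((B - 0) * (1 + 1) + 1)
      (\<lambda>s'. B \<le> B \<and> same_but {r} s s' \<and> out s' = out s \<and> reg s' r = B)"
    unfolding Inc_while_def
    by (rule achieves_While[where I = "\<lambda>k s'. k \<le> B \<and> same_but {r} s s' \<and> out s' = out s \<and> reg s' r = k"])
      (use assms in \<open>auto simp: same_but_def intro!: achieves_Assign\<close>)
  then show ?thesis
    by (rule achieves_weaken) (use \<open>B \<le> K\<close> in auto)
qed

section \<open>A program that writes the regular graph\<close>

text \<open>
  Since a guard is true iff it is nonzero, truncated subtraction expresses negation and comparison, and
  addition expresses disjunction. So a whole adjacency test is a single expression.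
\<close>

definition Not_e :: "aexp \<Rightarrow> aexp" where "Not_e a = Sub (Const 1) a"
definition And_e :: "aexp \<Rightarrow> aexp \<Rightarrow> aexp" where "And_e a b = Not_e (Add (Not_e a) (Not_e b))"
definition Less_e :: "aexp \<Rightarrow> aexp \<Rightarrow> aexp" where "Less_e a b = Sub b a"
definition Le_e :: "aexp \<Rightarrow> aexp \<Rightarrow> aexp" where "Le_e a b = Not_e (Sub a b)"
definition Eq_e :: "aexp \<Rightarrow> aexp \<Rightarrow> aexp" where "Eq_e a b = And_e (Le_e a b) (Le_e b a)"
definition Gap_e :: "aexp \<Rightarrow> aexp \<Rightarrow> aexp" where "Gap_e a b = Add (Sub a b) (Sub b a)"

primrec Times_e :: "nat \<Rightarrow> aexp \<Rightarrow> aexp" where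
  "Times_e 0 a = Const 0"
| "Times_e (Suc k) a = Add a (Times_e k a)"

lemma aval_Not_e [simp]: "aval (Not_e a) s = 0 \<longleftrightarrow> aval a s \<noteq> 0"
  by (auto simp: Not_e_def)
lemma aval_And_e [simp]: "aval (And_e a b) s = 0 \<longleftrightarrow> aval a s = 0 \<or> aval b s = 0"
  by (auto simp: And_e_def Not_e_def)
lemma aval_Less_e [simp]: "aval (Less_e a b) s = 0 \<longleftrightarrow> \<not> aval a s < aval b s"
  by (auto simp: Less_e_def)
lemma aval_Le_e [simp]: "aval (Le_e a b) s = 0 \<longleftrightarrow> \<not> aval a s \<le> aval b s"
  by (auto simp: Le_e_def)
lemma aval_Eq_e [simp]: "aval (Eq_e a b) s = 0 \<longleftrightarrow> aval a s \<noteq> aval b s"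
  by (auto simp: Eq_e_def)
lemma aval_Gap_e [simp]: "aval (Gap_e a b) s = gap (aval a s) (aval b s)"
  by (simp add: Gap_e_def gap_def)
lemma aval_Times_e [simp]: "aval (Times_e k a) s = k * aval a s"
  by (induction k) auto

text \<open>
  The registers hold the order \<open>n = 3p\<close> of the input graph, the number \<open>p\<close>, the coordinates \<open>(i, u)\<close> of
  the current row and \<open>(j, v)\<close> of the current column, the address of row \<open>u\<close> of the input matrix,
  and the degree of \<open>u\<close>.
\<close>

abbreviation (input) "n_reg \<equiv> 1 :: nat"
abbreviation (input) "p_reg \<equiv> 2 :: nat"
abbreviation (input) "i_reg \<equiv> 3 :: nat"
abbreviation (input) "u_reg \<equiv> 4 :: nat"
abbreviation (input) "j_reg \<equiv> 5 :: nat"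
abbreviation (input) "v_reg \<equiv> 6 :: nat"
abbreviation (input) "row_reg \<equiv> 7 :: nat"
abbreviation (input) "deg_reg \<equiv> 8 :: nat"

definition Sheets_e :: aexp where "Sheets_e = Times_e 4 (Reg p_reg)"
definition Tail_e :: aexp where "Tail_e = Add (Times_e 6 (Reg p_reg)) (Const 3)"

definition Step_e :: "aexp \<Rightarrow> aexp \<Rightarrow> aexp" where
  "Step_e a b = Add (And_e (Not_e a) (Not_e b)) (Add
     (And_e a (Eq_e b (Add a (Const 1))))
     (And_e (Eq_e (Add a (Const 1)) Sheets_e) (Eq_e b (Const 1))))"

definition Fibre_e :: "aexp \<Rightarrow> aexp \<Rightarrow> aexp \<Rightarrow> aexp \<Rightarrow> aexp" where
  "Fibre_e d r a b = And_e
     (Add (And_e (Less_e a d) (Le_e d b)) (And_e (Less_e b d) (Le_e d a)))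
     (Add (Less_e (Gap_e a b) r) (And_e (Le_e d (Gap_e a b)) (Less_e (Gap_e a b) (Add d r))))"

definition Circ_e :: "aexp \<Rightarrow> aexp \<Rightarrow> aexp" where
  "Circ_e a b = And_e
     (Le_e (Add (Times_e 2 (Reg p_reg)) (Const 2)) (Gap_e a b))
     (Less_e (Gap_e a b) (Add (Times_e 4 (Reg p_reg)) (Const 2)))"

text \<open>
  Reads the input entry from row \<open>u\<close> in both cases \<open>u < v\<close> and \<open>v < u\<close>; only the sheets \<open>i\<close> and \<open>j\<close>
  exchange their roles.
\<close>

definition Cover_e :: aexp where
  "Cover_e = Add
     (And_e (Mem (Add (Reg row_reg) (Reg v_reg)))
       (Add (And_e (Less_e (Reg u_reg) (Reg v_reg)) (Step_e (Reg i_reg) (Reg j_reg)))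
            (And_e (Less_e (Reg v_reg) (Reg u_reg)) (Step_e (Reg j_reg) (Reg i_reg)))))
     (And_e (Eq_e (Reg u_reg) (Reg v_reg))
       (Fibre_e (Times_e 2 (Reg p_reg)) (Sub (Times_e 2 (Reg p_reg)) (Reg deg_reg)) (Reg i_reg) (Reg j_reg)))"

text \<open>
  The input starts with \<open>n\<close> ones and a zero, so counting up to the first zero yields \<open>n\<close>; then \<open>p\<close> is
  the least number with \<open>n \<le> 3p\<close>.
\<close>

definition read_order :: com where
  "read_order = Seq (Inc_while (Mem (Reg n_reg)) n_reg)
     (Inc_while (Less_e (Times_e 3 (Reg p_reg)) (Reg n_reg)) p_reg)"

definition write_order :: com where
  "write_order = Seq (For i_reg Sheets_e (For u_reg (Reg n_reg) (Print (Const 1))))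
     (Seq (For i_reg Tail_e (Print (Const 1))) (Print (Const 0)))"

text \<open>
  The product \<open>u * n\<close> and the degree of \<open>u\<close> are computed by repeated addition. The registers \<open>j\<close> and
  \<open>v\<close> serve as counters here, before the columns use them.
\<close>

definition load_row :: com where
  "load_row =
     Seq (Seq (Assign row_reg (Add (Reg n_reg) (Const 1)))
              (For j_reg (Reg u_reg) (Assign row_reg (Add (Reg row_reg) (Reg n_reg)))))
         (Seq (Assign deg_reg (Const 0))
              (For v_reg (Reg n_reg) (Assign deg_reg (Add (Reg deg_reg) (Mem (Add (Reg row_reg) (Reg v_reg)))))))"

definition write_cover_row :: com where
  "write_cover_row = Seq load_row
     (Seq (For j_reg Sheets_e (For v_reg (Reg n_reg) (Print Cover_e))) (For j_reg Tail_e (Print (Const 0))))"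

definition write_tail_row :: com where
  "write_tail_row = Seq
     (For j_reg Sheets_e (For v_reg (Reg n_reg) (Print (Const 0))))
     (For j_reg Tail_e (Print (Circ_e (Reg i_reg) (Reg j_reg))))"

definition lift_program :: com where
  "lift_program = Seq read_order (Seq write_order (Seq
     (For i_reg Sheets_e (For u_reg (Reg n_reg) write_cover_row))
     (For i_reg Tail_e write_tail_row)))"

abbreviation (input) "grid_time K \<equiv> loop_time K (loop_time K 1)"
abbreviation (input) "row_time K \<equiv> grid_time K + loop_time K 1"
abbreviation (input) "load_time K \<equiv> (1 + loop_time K 1) + (1 + loop_time K 1)"

text \<open>
  The summands follow the structure of \<open>lift_program\<close>. The parameter \<open>K\<close> bounds the number of rounds
  of each single loop.
\<close>

definition lift_time :: "'a::comm_semiring_1 \<Rightarrow> 'a" where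
  "lift_time K = ((K * 2 + 1) + (K * 2 + 1)) + ((grid_time K + (loop_time K 1 + 1)) +
     (loop_time K (loop_time K (load_time K + row_time K)) + loop_time K (row_time K)))"

lemma poly_lift_time: "poly (lift_time q) x = lift_time (poly q x)"
  by (simp add: lift_time_def poly_loop_time)

text \<open>
  Brings a word that runs through all vertices into the shape that nested loops produce.
\<close>

lemma concat_map_lifted_list:
  "concat (map h (lifted_list p)) =
    concat (map (\<lambda>i. concat (map (\<lambda>u. h (Inl (i, u))) [0..<3 * p])) [0..<4 * p]) @
    concat (map (\<lambda>a. h (Inr a)) [0..<6 * p + 3])"
proof -
  have "concat (map h (map Inl (concat (map (\<lambda>i. map (Pair i) us) ks)))) =
      concat (map (\<lambda>i. concat (map (\<lambda>u. h (Inl (i, u))) us)) ks)" for us ks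
    by (induction ks) (simp_all add: o_def)
  then show ?thesis
    by (simp add: lifted_list_def product_concat_map o_def)
qed

lemma map_lifted_list:
  "map h (lifted_list p) =
    concat (map (\<lambda>i. concat (map (\<lambda>u. [h (Inl (i, u))]) [0..<3 * p])) [0..<4 * p]) @
    concat (map (\<lambda>a. [h (Inr a)]) [0..<6 * p + 3])"
  using concat_map_lifted_list[of "\<lambda>x. [h x]" p] by (metis concat_map_singleton)

text \<open>
  The matrix starts behind the unary order and its terminating zero, at address \<open>3p + 1\<close>.
\<close>

definition holds_matrix :: "nat \<Rightarrow> (nat \<Rightarrow> nat \<Rightarrow> bool) \<Rightarrow> state \<Rightarrow> bool" where
  "holds_matrix p B s \<longleftrightarrow> reg s n_reg = 3 * p \<and> reg s p_reg = p \<and>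
     (\<forall>u<3 * p. \<forall>v<3 * p. mem s (3 * p + 1 + u * (3 * p) + v) = of_bool (B u v))"

lemma holds_matrix_same_but:
  "holds_matrix p B s \<Longrightarrow> same_but R s s' \<Longrightarrow> n_reg \<notin> R \<Longrightarrow> p_reg \<notin> R \<Longrightarrow> holds_matrix p B s'"
  by (auto simp: holds_matrix_def same_but_def)

context
  fixes p :: nat and B :: "nat \<Rightarrow> nat \<Rightarrow> bool" and K :: nat
  assumes K: "6 * p + 3 \<le> K"
begin

lemma loop_bounds:
  assumes "holds_matrix p B s" "same_but R s s'" "n_reg \<notin> R" "p_reg \<notin> R"
  shows "aval Sheets_e s' = 4 * p" "aval Tail_e s' = 6 * p + 3" "aval (Reg n_reg) s' = 3 * p"
  using holds_matrix_same_but[OF assms] by (auto simp: holds_matrix_def Sheets_e_def Tail_e_def)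

lemma le_K: "4 * p \<le> K" "3 * p \<le> K"
  using K by auto

lemma prints_write_order:
  assumes s: "holds_matrix p B s"
  shows "prints {i_reg, u_reg} write_order s
    (grid_time K + (loop_time K 1 + 1))
    (replicate (length (lifted_list p)) True @ [False])"
proof -
  have "prints {i_reg, u_reg} write_order s
    (grid_time K + (loop_time K 1 + 1))
    (concat (map (\<lambda>i. concat (map (\<lambda>u. [True]) [0..<3 * p])) [0..<4 * p]) @
     (concat (map (\<lambda>a. [True]) [0..<6 * p + 3]) @ [False]))"
    unfolding write_order_def
  proof (intro prints_Seq prints_grid prints_row prints_Print)
  qed (use K le_K loop_bounds[OF s] loop_bounds[OF holds_matrix_same_but[OF s]] in auto)
  then show ?thesis
    using map_lifted_list[of "\<lambda>_. True" p] by (simp add: map_replicate_const)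
qed

lemma achieves_load_row:
  assumes s: "holds_matrix p B s" and u: "reg s u_reg = u" "u < 3 * p"
  shows "achieves load_row s (load_time K)
    (\<lambda>s'. same_but {j_reg, v_reg, row_reg, deg_reg} s s' \<and> out s' = out s \<and>
      (reg s' row_reg = 3 * p + 1 + u * (3 * p) \<and> reg s' deg_reg = row_degree (3 * p) B u))"
  unfolding load_row_def
proof (rule achieves_Seq)
  let ?R = "{j_reg, v_reg, row_reg, deg_reg}" and ?start = "3 * p + 1 + u * (3 * p)"
  let ?s = "s\<lparr>reg := (reg s)(row_reg := 3 * p + 1)\<rparr>"
  have s1: "holds_matrix p B ?s" "same_but ?R s ?s"
    using s by (auto simp: holds_matrix_def same_but_def)
  show "achieves (Seq (Assign row_reg (Add (Reg n_reg) (Const 1)))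
      (For j_reg (Reg u_reg) (Assign row_reg (Add (Reg row_reg) (Reg n_reg))))) s (1 + loop_time K 1)
      (\<lambda>s'. same_but ?R s s' \<and> out s' = out s \<and> reg s' row_reg = ?start)"
  proof (rule achieves_Seq)
    show "achieves (Assign row_reg (Add (Reg n_reg) (Const 1))) s 1 (\<lambda>s'. s' = ?s)"
      using s by (intro achieves_Assign) (simp_all add: holds_matrix_def)
    show "achieves (For j_reg (Reg u_reg) (Assign row_reg (Add (Reg row_reg) (Reg n_reg)))) s' (loop_time K 1)
        (\<lambda>s'. same_but ?R s s' \<and> out s' = out s \<and> reg s' row_reg = ?start)"
      if "s' = ?s" for s'
      unfolding that
    proof (rule achieves_weaken[OF achieves_sum[where R = ?R and B = u and K = K and g = "\<lambda>_. 3 * p"]])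
      show "u \<le> K" using u le_K by simp
      show "aval (Reg n_reg) s' = 3 * p" if "same_but {j_reg, row_reg} ?s s'" for s'
        using loop_bounds(3)[OF s1(1) that] by simp
    qed (use u in \<open>auto simp: same_but_def\<close>)
  qed
  fix s' assume s': "same_but ?R s s' \<and> out s' = out s \<and> reg s' row_reg = ?start"
  let ?s' = "s'\<lparr>reg := (reg s')(deg_reg := 0)\<rparr>"
  have s2: "holds_matrix p B ?s'"
    using s s' by (auto simp: holds_matrix_def same_but_def)
  have deg: "(\<Sum>v<3 * p. of_bool (B u v)) = row_degree (3 * p) B u"
  proof -
    have "(\<Sum>v<3 * p. of_bool (B u v)) = card ({..<3 * p} \<inter> {v. B u v})"
      by (simp add: of_bool_def sum.If_cases)
    also have "{..<3 * p} \<inter> {v. B u v} = {v. v < 3 * p \<and> B u v}"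
      by auto
    finally show ?thesis
      by (simp add: row_degree_def)
  qed
  show "achieves (Seq (Assign deg_reg (Const 0))
      (For v_reg (Reg n_reg) (Assign deg_reg (Add (Reg deg_reg) (Mem (Add (Reg row_reg) (Reg v_reg)))))))
      s' (1 + loop_time K 1) (\<lambda>s'. same_but ?R s s' \<and> out s' = out s \<and>
        (reg s' row_reg = ?start \<and> reg s' deg_reg = row_degree (3 * p) B u))"
  proof (rule achieves_Seq)
    show "achieves (Assign deg_reg (Const 0)) s' 1 (\<lambda>s''. s'' = ?s')"
      by (intro achieves_Assign) simp_all
    show "achieves (For v_reg (Reg n_reg) (Assign deg_reg (Add (Reg deg_reg) (Mem (Add (Reg row_reg) (Reg v_reg))))))
        s'' (loop_time K 1) (\<lambda>s'. same_but ?R s s' \<and> out s' = out s \<and>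
        (reg s' row_reg = ?start \<and> reg s' deg_reg = row_degree (3 * p) B u))"
      if "s'' = ?s'" for s''
      unfolding that
    proof (rule achieves_weaken[OF achieves_sum[where R = "{v_reg, deg_reg}" and B = "3 * p" and K = K and g = "\<lambda>v. of_bool (B u v)"]])
      show "aval (Reg n_reg) t = 3 * p" if "same_but {v_reg, deg_reg} ?s' t" for t
        using loop_bounds(3)[OF s2 that] by simp
      show "aval (Mem (Add (Reg row_reg) (Reg v_reg))) t = of_bool (B u v)"
        if "v < 3 * p" "same_but {v_reg, deg_reg} ?s' t" "reg t v_reg = v" for v t
        using s2 s' u that by (auto simp: holds_matrix_def same_but_def)
    qed (use s' deg le_K in \<open>auto simp: same_but_def\<close>)
  qed
qed

text \<open>
  The expression \<open>Cover_e\<close> is the first clause of \<open>lifted\<close>, evaluated in the registers.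
\<close>

lemma prints_write_cover_row:
  assumes s: "holds_matrix p B s" and i: "reg s i_reg = i" and u: "reg s u_reg = u" "u < 3 * p"
  shows "prints {j_reg, v_reg, row_reg, deg_reg} write_cover_row s
    (load_time K + row_time K)
    (map (lifted p B (Inl (i, u))) (lifted_list p))"
  unfolding write_cover_row_def map_lifted_list
proof (rule prints_after[OF achieves_load_row[OF s u]])
  let ?R = "{j_reg, v_reg, row_reg, deg_reg}"
  fix s' assume s': "same_but ?R s s'"
    and loaded: "reg s' row_reg = 3 * p + 1 + u * (3 * p) \<and> reg s' deg_reg = row_degree (3 * p) B u"
  have h: "holds_matrix p B s'" and iu: "reg s' i_reg = i" "reg s' u_reg = u"
    using holds_matrix_same_but[OF s s'] s' i u by (auto simp: same_but_def)
  have "prints {j_reg, v_reg}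
     (Seq (For j_reg Sheets_e (For v_reg (Reg n_reg) (Print Cover_e))) (For j_reg Tail_e (Print (Const 0))))
     s' (row_time K)
     (concat (map (\<lambda>j. concat (map (\<lambda>v. [lifted p B (Inl (i, u)) (Inl (j, v))]) [0..<3 * p])) [0..<4 * p]) @
      concat (map (\<lambda>a. [lifted p B (Inl (i, u)) (Inr a)]) [0..<6 * p + 3]))"
  proof (intro prints_Seq prints_grid prints_row)
    fix j v t assume t: "j < 4 * p" "v < 3 * p" "same_but {j_reg, v_reg} s' t" "reg t j_reg = j" "reg t v_reg = v"
    have regs: "reg t i_reg = i" "reg t u_reg = u" "reg t p_reg = p"
        "reg t row_reg = 3 * p + 1 + u * (3 * p)" "reg t deg_reg = row_degree (3 * p) B u"
      using t(3) iu loaded h by (auto simp: same_but_def holds_matrix_def)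
    have "mem t (3 * p + 1 + u * (3 * p) + v) = of_bool (B u v)"
      using h t(2,3) u(2) by (auto simp: same_but_def holds_matrix_def)
    then show "aval Cover_e t \<noteq> 0 \<longleftrightarrow> lifted p B (Inl (i, u)) (Inl (j, v))"
      using regs t(4,5) by (simp add: Cover_e_def Step_e_def Fibre_e_def Sheets_e_def step_def fibre_def cong: conj_cong)
  qed (use K le_K loop_bounds[OF h] loop_bounds[OF holds_matrix_same_but[OF h]] in auto)
  then show "prints ?R
     (Seq (For j_reg Sheets_e (For v_reg (Reg n_reg) (Print Cover_e))) (For j_reg Tail_e (Print (Const 0))))
     s' (row_time K)
     (concat (map (\<lambda>j. concat (map (\<lambda>v. [lifted p B (Inl (i, u)) (Inl (j, v))]) [0..<3 * p])) [0..<4 * p]) @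
      concat (map (\<lambda>a. [lifted p B (Inl (i, u)) (Inr a)]) [0..<6 * p + 3]))"
    unfolding prints_def by (rule achieves_weaken) (auto simp: same_but_def)
qed

lemma prints_write_tail_row:
  assumes s: "holds_matrix p B s" and i: "reg s i_reg = a"
  shows "prints {j_reg, v_reg} write_tail_row s (row_time K)
    (map (lifted p B (Inr a)) (lifted_list p))"
  unfolding write_tail_row_def map_lifted_list
proof (intro prints_Seq prints_grid prints_row)
  fix s' b t assume "same_but {j_reg, v_reg} s s'" "same_but {j_reg, v_reg} s' t" "reg t j_reg = b"
  then show "aval (Circ_e (Reg i_reg) (Reg j_reg)) t \<noteq> 0 \<longleftrightarrow> lifted p B (Inr a) (Inr b)"
    using s i by (simp add: Circ_e_def circ_def same_but_def holds_matrix_def)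
qed (use K le_K loop_bounds[OF s] loop_bounds[OF holds_matrix_same_but[OF s]] in auto)

lemma prints_rows:
  assumes s: "holds_matrix p B s"
  defines "R \<equiv> {i_reg, u_reg, j_reg, v_reg, row_reg, deg_reg}"
  shows "prints R (Seq (For i_reg Sheets_e (For u_reg (Reg n_reg) write_cover_row)) (For i_reg Tail_e write_tail_row)) s
    (loop_time K (loop_time K (load_time K + row_time K)) +
      loop_time K (row_time K))
    (concat (map (\<lambda>x. map (lifted p B x) (lifted_list p)) (lifted_list p)))"
  unfolding concat_map_lifted_list[where h = "\<lambda>x. map (lifted p B x) (lifted_list p)"]
proof (rule prints_Seq)
  have R: "n_reg \<notin> R" "p_reg \<notin> R" "i_reg \<in> R" "u_reg \<in> R - {i_reg}"
    by (auto simp: R_def)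
  note keep = holds_matrix_same_but[OF _ _ R(1,2)]
  show "prints R (For i_reg Sheets_e (For u_reg (Reg n_reg) write_cover_row)) s
      (loop_time K (loop_time K (load_time K + row_time K)))
      (concat (map (\<lambda>i. concat (map (\<lambda>u. map (lifted p B (Inl (i, u))) (lifted_list p)) [0..<3 * p])) [0..<4 * p]))"
  proof (rule prints_For)
    fix i s' assume i: "same_but R s s'" "reg s' i_reg = i"
    have h: "holds_matrix p B s'" using keep[OF s i(1)] .
    show "prints (R - {i_reg}) (For u_reg (Reg n_reg) write_cover_row) s'
        (loop_time K (load_time K + row_time K))
        (concat (map (\<lambda>u. map (lifted p B (Inl (i, u))) (lifted_list p)) [0..<3 * p]))"
    proof (rule prints_For)
      fix u t assume u: "u < 3 * p" "same_but (R - {i_reg}) s' t" "reg t u_reg = u"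
      have "R - {i_reg} - {u_reg} = {j_reg, v_reg, row_reg, deg_reg}" by (auto simp: R_def)
      moreover have "holds_matrix p B t" "reg t i_reg = i"
        using holds_matrix_same_but[OF h u(2)] R u(2) i(2) by (auto simp: same_but_def)
      ultimately show "prints (R - {i_reg} - {u_reg}) write_cover_row t
        (load_time K + row_time K)
        (map (lifted p B (Inl (i, u))) (lifted_list p))"
        using prints_write_cover_row u by simp
    qed (use R le_K loop_bounds[OF h] in auto)
  qed (use R le_K loop_bounds[OF s] in auto)
  fix s' assume s': "same_but R s s'"
  have h: "holds_matrix p B s'" using keep[OF s s'] .
  show "prints R (For i_reg Tail_e write_tail_row) s' (loop_time K (row_time K))
      (concat (map (\<lambda>a. map (lifted p B (Inr a)) (lifted_list p)) [0..<6 * p + 3]))"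
  proof (rule prints_For)
    fix a t assume a: "same_but R s' t" "reg t i_reg = a"
    show "prints (R - {i_reg}) write_tail_row t (row_time K)
        (map (lifted p B (Inr a)) (lifted_list p))"
      using prints_write_tail_row[OF keep[OF h a(1)] a(2)] unfolding prints_def
      by (rule achieves_weaken) (auto simp: same_but_def R_def)
  qed (use R K loop_bounds[OF h] in auto)
qed

end


lemma nth_concat_matrix:
  assumes "u < length vs" "v < length vs"
  shows "concat (map (\<lambda>x. map (f x) vs) vs) ! (u * length vs + v) = f (vs ! u) (vs ! v)"
proof -
  have "concat (map (\<lambda>x. map (f x) vs) us) ! (u * length vs + v) = f (us ! u) (vs ! v)"
    if "u < length us" for us
    using that assms(2)
  proof (induction us arbitrary: u)
    case (Cons x us)
    then show ?case
      by (cases u) (auto simp: nth_append)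
  qed simp
  then show ?thesis
    using assms(1) .
qed

text \<open>
  The function computed by the program has to be given on words, so the order and the
  matrix are read off the word.
\<close>

definition word_order :: "bool list \<Rightarrow> nat" where
  "word_order w = length (takeWhile id w)"

definition word_adjacency :: "bool list \<Rightarrow> nat \<Rightarrow> nat \<Rightarrow> bool" where
  "word_adjacency w u v = w ! (word_order w + 1 + u * word_order w + v)"

lemma word_order_encode_graph: "word_order (encode_graph vs X) = length vs"
  by (simp add: word_order_def encode_graph_def takeWhile_append)

lemma word_adjacency_encode_graph:
  assumes "u < length vs" "v < length vs"
  shows "word_adjacency (encode_graph vs X) u v = adjacency vs X u v"
proof -
  have "encode_graph vs X ! (length vs + 1 + u * length vs + v) =
      concat (map (\<lambda>u. map (\<lambda>v. {u, v} \<in> edges X) vs) vs) ! (u * length vs + v)"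
    unfolding encode_graph_def by (simp add: nth_append)
  then show ?thesis
    using nth_concat_matrix[OF assms, of "\<lambda>u v. {u, v} \<in> edges X"]
    by (simp add: word_adjacency_def word_order_encode_graph adjacency_def)
qed

lemma length_encode_graph: "length (encode_graph vs X) = length vs + 1 + length vs * length vs"
  by (simp add: encode_graph_def length_concat o_def sum_list_triv)

definition lift_word :: "bool list \<Rightarrow> bool list" where
  "lift_word w = lifted_word (word_order w div 3) (word_adjacency w)"

lemma lift_word_encode_graph:
  assumes "length vs = 3 * p"
  shows "lift_word (encode_graph vs X) = lifted_word p (adjacency vs X)"
  unfolding lift_word_def word_order_encode_graph
  using assms by (auto simp: word_adjacency_encode_graph intro: lifted_word_cong)

lemma achieves_read_order:
  assumes w: "w = encode_graph vs X" and len: "length vs = 3 * p" and K: "3 * p \<le> K"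
  shows "achieves read_order (init_state w) ((K * 2 + 1) + (K * 2 + 1))
    (\<lambda>s'. same_but {n_reg, p_reg} (init_state w) s' \<and> out s' = out (init_state w) \<and>
      holds_matrix p (word_adjacency w) s')"
  unfolding read_order_def
proof (rule achieves_Seq[OF achieves_Inc_while[where B = "3 * p" and K = K]])
  have lw: "length w = 3 * p + 1 + 3 * p * (3 * p)"
    using len by (simp add: w length_encode_graph)
  show "aval (Mem (Reg n_reg)) s' \<noteq> 0 \<longleftrightarrow> k < 3 * p"
    if "k \<le> 3 * p" "same_but {n_reg} (init_state w) s'" "reg s' n_reg = k" for k s'
  proof -
    (* At k = 3 * p the separator of the encoding stops the search. *)
    have "w ! k \<longleftrightarrow> k < 3 * p"
      using that(1) len by (auto simp: w encode_graph_def nth_append)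
    then show ?thesis
      using that lw by (auto simp: same_but_def init_state_def)
  qed
  fix s assume s: "same_but {n_reg} (init_state w) s \<and> out s = out (init_state w) \<and> reg s n_reg = 3 * p"
  show "achieves (Inc_while (Less_e (Times_e 3 (Reg p_reg)) (Reg n_reg)) p_reg) s (K * 2 + 1)
      (\<lambda>s'. same_but {n_reg, p_reg} (init_state w) s' \<and> out s' = out (init_state w) \<and>
        holds_matrix p (word_adjacency w) s')"
  proof (rule achieves_weaken[OF achieves_Inc_while[where B = p and K = K]])
    fix s' assume s': "same_but {p_reg} s s' \<and> out s' = out s \<and> reg s' p_reg = p"
    have "mem s' (3 * p + 1 + u * (3 * p) + v) = of_bool (word_adjacency w u v)"
      if "u < 3 * p" "v < 3 * p" for u v
    proof -
      have "(u + 1) * (3 * p) \<le> 3 * p * (3 * p)"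
        using that by (intro mult_le_mono1) simp
      then have "3 * p + 1 + u * (3 * p) + v < length w"
        using that unfolding lw by simp
      then show ?thesis
        using s s' len by (simp add: same_but_def init_state_def word_adjacency_def w word_order_encode_graph)
    qed
    then show "same_but {n_reg, p_reg} (init_state w) s' \<and> out s' = out (init_state w) \<and>
        holds_matrix p (word_adjacency w) s'"
      using s s' by (auto simp: same_but_def holds_matrix_def)
  qed (use s K in \<open>auto simp: same_but_def init_state_def\<close>)
qed (use K in \<open>auto simp: init_state_def\<close>)

text \<open>
  No loop has more than \<open>6p + 3\<close> rounds, and a word of length \<open>l\<close> has \<open>3p \<le> l\<close>; hence \<open>K = 2l + 3\<close>
  bounds the rounds of every loop.
\<close>

lemma polytime_lift_word:
  "polytime_on {encode_graph vs X |(X :: nat ugraph) vs p. length vs = 3 * p} lift_word"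
  unfolding polytime_on_def
proof (rule exI[of _ lift_program], rule exI[of _ "lift_time [:3, 2:]"], rule ballI)
  fix w assume "w \<in> {encode_graph vs X |(X :: nat ugraph) vs p. length vs = 3 * p}"
  then obtain X :: "nat ugraph" and vs p where w: "w = encode_graph vs X" and len: "length vs = 3 * p"
    by blast
  let ?q = "lift_time [:3, 2:] :: nat poly" and ?K = "2 * length w + 3"
  have K: "6 * p + 3 \<le> ?K" "3 * p \<le> ?K"
    using len by (simp_all add: w length_encode_graph)
  have poly_q: "poly ?q (length w) = lift_time ?K"
    by (simp add: poly_lift_time algebra_simps)
  define R where "R = {n_reg, p_reg, i_reg, u_reg, j_reg, v_reg, row_reg, deg_reg}"
  have weaken: "prints R c s T out'" if "prints R' c s T out'" "R' \<subseteq> R" for R' c s T out'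
    using that unfolding prints_def by (elim achieves_weaken) (auto simp: same_but_def)
  have "prints R lift_program (init_state w) (lift_time ?K) (lifted_word p (word_adjacency w))"
    unfolding lift_program_def lift_time_def
  proof (rule prints_after)
    show "achieves read_order (init_state w) (?K * 2 + 1 + (?K * 2 + 1))
        (\<lambda>s'. same_but R (init_state w) s' \<and> out s' = out (init_state w) \<and> holds_matrix p (word_adjacency w) s')"
      by (rule achieves_weaken[OF achieves_read_order[OF w len K(2)]]) (auto simp: same_but_def R_def)
    fix s assume s: "holds_matrix p (word_adjacency w) s"
    have split: "lifted_word p (word_adjacency w) = (replicate (length (lifted_list p)) True @ [False]) @
        concat (map (\<lambda>x. map (lifted p (word_adjacency w) x) (lifted_list p)) (lifted_list p))"
      by (simp add: lifted_word_def)
    show "prints R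
       (Seq write_order (Seq (For i_reg Sheets_e (For u_reg (Reg n_reg) write_cover_row)) (For i_reg Tail_e write_tail_row)))
       s (grid_time ?K + (loop_time ?K 1 + 1) +
          (loop_time ?K (loop_time ?K (load_time ?K + row_time ?K)) +
           loop_time ?K (row_time ?K)))
       (lifted_word p (word_adjacency w))"
      unfolding split prints_def
    proof (rule achieves_Seq[OF prints_write_order[OF K(1) s, unfolded prints_def]])
      fix s' assume s': "same_but {i_reg, u_reg} s s' \<and> out s' = out s @ replicate (length (lifted_list p)) True @ [False]"
      then have "holds_matrix p (word_adjacency w) s'"
        using holds_matrix_same_but[OF s, of "{i_reg, u_reg}" s'] by simp
      from prints_rows[OF K(1) this]
      show "achieves (Seq (For i_reg Sheets_e (For u_reg (Reg n_reg) write_cover_row)) (For i_reg Tail_e write_tail_row)) s'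
         (loop_time ?K (loop_time ?K (load_time ?K + row_time ?K)) +
           loop_time ?K (row_time ?K))
         (\<lambda>s'. same_but R s s' \<and> out s' = out s @ (replicate (length (lifted_list p)) True @ [False]) @
            concat (map (\<lambda>x. map (lifted p (word_adjacency w) x) (lifted_list p)) (lifted_list p)))"
        unfolding prints_def by (rule achieves_weaken) (use s' in \<open>auto simp: same_but_def R_def\<close>)
    qed
  qed
  moreover have "lifted_word p (word_adjacency w) = lift_word w"
    using len by (simp add: lift_word_def w word_order_encode_graph)
  ultimately obtain t s where "exec lift_program (init_state w) t s" "t \<le> poly ?q (length w)" "out s = lift_word w"
    unfolding prints_def achieves_def poly_q by (auto simp: init_state_def)
  then show "\<exists>t s. exec lift_program (init_state w) t s \<and> out s = lift_word w \<and> t \<le> poly ?q (length w)"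
    by blast
qed

theorem lemma8:
  "\<exists>f. polytime_on
         {encode_graph vs X | (X :: nat ugraph) vs p.
            simple_graph X \<and> enumerates vs X \<and> K4_free X \<and>
            card (verts X) = 3 * p \<and> max_degree X \<le> 2 * p} f \<and>
       (\<forall>(X :: nat ugraph) vs p d.
          simple_graph X \<and> enumerates vs X \<and> K4_free X \<and>
          card (verts X) = 3 * p \<and> d = 2 * p \<and> max_degree X \<le> d \<longrightarrow>
          (\<exists>(H :: nat ugraph) ws.
             simple_graph H \<and> enumerates (vs @ ws) H \<and>
             f (encode_graph vs X) = encode_graph (vs @ ws) H \<and>
             verts X \<subseteq> verts H \<and>
             regular d H \<and> K4_free H \<and> odd (card (verts H)) \<and>
             triangles H = triangles X \<and>
             card (verts H) \<ge> 2 * d + 2 \<and>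
             (has_disjoint_triangles X p \<longleftrightarrow> has_disjoint_triangles H (d div 2))))"
proof (intro exI[of _ lift_word] conjI allI impI)
  let ?D = "{encode_graph vs X |(X :: nat ugraph) vs p. length vs = 3 * p}"
  let ?E = "{encode_graph vs X | (X :: nat ugraph) vs p. simple_graph X \<and> enumerates vs X \<and>
    K4_free X \<and> card (verts X) = 3 * p \<and> max_degree X \<le> 2 * p}"
  have length_vs: "length vs = card (verts X)" if "enumerates vs X" for vs and X :: "nat ugraph"
    using that distinct_card[of vs] by (simp add: enumerates_def)
  then have "?E \<subseteq> ?D"
    by fastforce
  then show "polytime_on ?E lift_word"
    using polytime_lift_word unfolding polytime_on_def by (meson subsetD)
  fix X :: "nat ugraph" and vs p d
  assume *: "simple_graph X \<and> enumerates vs X \<and> K4_free X \<and>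
    card (verts X) = 3 * p \<and> d = 2 * p \<and> max_degree X \<le> d"
  then have X: "simple_graph X" "enumerates vs X" "K4_free X" "card (verts X) = 3 * p" "max_degree X \<le> 2 * p"
    by auto
  define H where "H = draw (embed vs) (lifted_verts p) (lifted p (adjacency vs X))"
  note H = regular_supergraph[OF X, folded H_def]
  obtain ws where ws: "enumerates (vs @ ws) H" "encode_graph (vs @ ws) H = lifted_word p (adjacency vs X)"
    using H(7) by blast
  have "f (encode_graph vs X) = encode_graph (vs @ ws) H" if "f = lift_word" for f
    using that lift_word_encode_graph[of vs p X] length_vs[OF X(2)] X(4) ws(2) by simp
  moreover have "has_disjoint_triangles X p \<longleftrightarrow> has_disjoint_triangles H (d div 2)"
    using * H(4) by (simp add: has_disjoint_triangles_def)
  moreover have "odd (card (verts H))" "card (verts H) \<ge> 2 * d + 2"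
    using * unfolding H(6) by simp_all
  ultimately show "\<exists>(H :: nat ugraph) ws.
       simple_graph H \<and> enumerates (vs @ ws) H \<and>
       lift_word (encode_graph vs X) = encode_graph (vs @ ws) H \<and>
       verts X \<subseteq> verts H \<and>
       regular d H \<and> K4_free H \<and> odd (card (verts H)) \<and>
       triangles H = triangles X \<and>
       card (verts H) \<ge> 2 * d + 2 \<and>
       (has_disjoint_triangles X p \<longleftrightarrow> has_disjoint_triangles H (d div 2))"
    using H ws(1) * by blast
qed

end
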